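(* Let $\kappa,\rho,\gamma>0$ and let $\lambda_2=\sup\sigma(\mathcal{H}^2)$. Assume $\lambda_2>0$. Then $\lambda_2$ belongs to the point spectrum of $\mathcal{H}^2$, is isolated in the point spectrum, and has a one-dimensional eigenspace. The corresponding eigenfunction may be chosen strictly positive.
   Context: $\mathcal{H}^2:=\mathcal{A}^2+\gamma V^2$ is the bounded self-adjoint operator on $l^2(\mathbb{Z}^{2d})$, $d\ge1$, where for $x=(x_1,x_2)$ with $x_1,x_2\in\mathbb{Z}^d$: $(V^2f)(x)=(\delta_0(x_1)+\delta_0(x_2))f(x)$ and $$\mathcal{A}^2f(x)=\kappa\sum_{e\in\mathbb{Z}^{2d},\,|e|=1}\big(f(x+e)-f(x)\big)+\rho\sum_{e\in\mathbb{Z}^d,\,|e|=1}\big(f(x_1+e,x_2+e)-f(x)\big).$$ $\sigma(\cdot)$ denotes the spectrum; the point spectrum is the set of eigenvalues. *)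

theory Defs
  imports "HOL-Analysis.Analysis" "HOL-Library.Function_Algebras"
begin

section \<open>The Hilbert space of square summable functions and its bounded operators\<close>

definition ell2 :: "('a \<Rightarrow> complex) set" where
  "ell2 = {f. (\<lambda>x. (cmod (f x))\<^sup>2) summable_on UNIV}"

definition ell2_norm :: "('a \<Rightarrow> complex) \<Rightarrow> real" where
  "ell2_norm f = sqrt (\<Sum>\<^sub>\<infinity>x. (cmod (f x))\<^sup>2)"

text \<open>Operators are functions on all of \<open>'a \<Rightarrow> complex\<close>; only their values on \<^const>\<open>ell2\<close> matter.\<close>

definition ell2_bounded_op :: "(('a \<Rightarrow> complex) \<Rightarrow> ('a \<Rightarrow> complex)) \<Rightarrow> bool" where
  "ell2_bounded_op T \<longleftrightarrow>
     (\<forall>f\<in>ell2. T f \<in> ell2) \<and>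
     (\<forall>f\<in>ell2. \<forall>g\<in>ell2. T (\<lambda>x. f x + g x) = (\<lambda>x. T f x + T g x)) \<and>
     (\<forall>c. \<forall>f\<in>ell2. T (\<lambda>x. c * f x) = (\<lambda>x. c * T f x)) \<and>
     (\<exists>C. \<forall>f\<in>ell2. ell2_norm (T f) \<le> C * ell2_norm f)"

definition ell2_resolvent_set :: "(('a \<Rightarrow> complex) \<Rightarrow> ('a \<Rightarrow> complex)) \<Rightarrow> complex set" where
  "ell2_resolvent_set T =
     {z. \<exists>R. ell2_bounded_op R \<and>
        (\<forall>f\<in>ell2. R (\<lambda>x. T f x - z * f x) = f \<and> (\<lambda>x. T (R f) x - z * R f x) = f)}"

definition ell2_spectrum :: "(('a \<Rightarrow> complex) \<Rightarrow> ('a \<Rightarrow> complex)) \<Rightarrow> complex set" where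
  "ell2_spectrum T = - ell2_resolvent_set T"

definition ell2_eigenspace ::
  "(('a \<Rightarrow> complex) \<Rightarrow> ('a \<Rightarrow> complex)) \<Rightarrow> complex \<Rightarrow> ('a \<Rightarrow> complex) set" where
  "ell2_eigenspace T z = {f \<in> ell2. T f = (\<lambda>x. z * f x)}"

definition ell2_point_spectrum :: "(('a \<Rightarrow> complex) \<Rightarrow> ('a \<Rightarrow> complex)) \<Rightarrow> complex set" where
  "ell2_point_spectrum T = {z. \<exists>f\<in>ell2_eigenspace T z. f \<noteq> (\<lambda>x. 0)}"

global_interpretation cfun: vector_space "\<lambda>(c::complex) (f::'a \<Rightarrow> complex) x. c * f x"
  defines cfun_dim = cfun.dim
  by unfold_locales (auto simp: fun_eq_iff algebra_simps)


section \<open>The operator\<close>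

text \<open>
  The lattice of dimension \<open>d = CARD('d) \<ge> 1\<close> is \<^typ>\<open>int ^ 'd\<close>. The lattice points with
  \<open>|e| = 1\<close> are the signed coordinate vectors, so it is immaterial whether the norm is
  the Euclidean one, as here, or the \<open>\<ell>\<^sup>1\<close> one.
\<close>

definition real_of_lattice :: "int ^ 'd::finite \<Rightarrow> real ^ 'd" where
  "real_of_lattice v = (\<chi> i. real_of_int (v $ i))"

definition lattice_units :: "(int ^ 'd::finite) set" where
  "lattice_units = {e. norm (real_of_lattice e) = 1}"

definition lattice_pair_units :: "((int ^ 'd::finite) \<times> (int ^ 'd)) set" where
  "lattice_pair_units = {e. norm (real_of_lattice (fst e), real_of_lattice (snd e)) = 1}"

lemma finite_lattice_ball: "finite {e :: int ^ 'd::finite. norm (real_of_lattice e) \<le> 1}"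
proof (rule finite_subset)
  show "{e :: int ^ 'd. norm (real_of_lattice e) \<le> 1}
      \<subseteq> (\<lambda>f. \<chi> i. f i) ` (UNIV \<rightarrow>\<^sub>E {-1..1})"
  proof
    fix e :: "int ^ 'd"
    assume "e \<in> {e. norm (real_of_lattice e) \<le> 1}"
    then have "\<bar>real_of_int (e $ i)\<bar> \<le> 1" for i
      using component_le_norm_cart[of "real_of_lattice e" i] by (simp add: real_of_lattice_def)
    then have "(\<lambda>i. e $ i) \<in> UNIV \<rightarrow>\<^sub>E {-1..1}"
      by (auto simp: abs_le_iff) (smt (verit, best) of_int_le_iff of_int_minus of_int_1)+
    moreover have "e = (\<chi> i. e $ i)" by simp
    ultimately show "e \<in> (\<lambda>f. \<chi> i. f i) ` (UNIV \<rightarrow>\<^sub>E {-1..1})" by blast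
  qed
qed (simp add: finite_PiE)

lemma finite_lattice_units: "finite (lattice_units :: (int ^ 'd::finite) set)"
  by (rule finite_subset[OF _ finite_lattice_ball]) (auto simp: lattice_units_def)

lemma finite_lattice_pair_units: "finite (lattice_pair_units :: ((int ^ 'd::finite) \<times> (int ^ 'd)) set)"
proof (rule finite_subset)
  let ?B = "{e :: int ^ 'd. norm (real_of_lattice e) \<le> 1}"
  show "lattice_pair_units \<subseteq> ?B \<times> ?B"
  proof
    fix e :: "(int ^ 'd) \<times> (int ^ 'd)"
    assume "e \<in> lattice_pair_units"
    then have "norm (real_of_lattice (fst e), real_of_lattice (snd e)) = 1"
      by (simp add: lattice_pair_units_def)
    then show "e \<in> ?B \<times> ?B"
      using norm_fst_le[of "real_of_lattice (fst e)" "real_of_lattice (snd e)"]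
        norm_snd_le[of "real_of_lattice (snd e)" "real_of_lattice (fst e)"]
      by (simp add: mem_Times_iff)
  qed
qed (simp add: finite_lattice_ball)

definition op_A2 :: "real \<Rightarrow> real \<Rightarrow> ((int ^ 'd::finite) \<times> (int ^ 'd) \<Rightarrow> complex) \<Rightarrow>
    (int ^ 'd) \<times> (int ^ 'd) \<Rightarrow> complex" where
  "op_A2 \<kappa> \<rho> f x =
     complex_of_real \<kappa> * (\<Sum>e\<in>lattice_pair_units. f (x + e) - f x) +
     complex_of_real \<rho> * (\<Sum>e\<in>lattice_units. f (fst x + e, snd x + e) - f x)"

definition op_V2 :: "((int ^ 'd::finite) \<times> (int ^ 'd) \<Rightarrow> complex) \<Rightarrow>
    (int ^ 'd) \<times> (int ^ 'd) \<Rightarrow> complex" where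
  "op_V2 f x = (indicator {0} (fst x) + indicator {0} (snd x)) * f x"

definition op_H2 :: "real \<Rightarrow> real \<Rightarrow> real \<Rightarrow> ((int ^ 'd::finite) \<times> (int ^ 'd) \<Rightarrow> complex) \<Rightarrow>
    (int ^ 'd) \<times> (int ^ 'd) \<Rightarrow> complex" where
  "op_H2 \<kappa> \<rho> \<gamma> f x = op_A2 \<kappa> \<rho> f x + complex_of_real \<gamma> * op_V2 f x"

text \<open>
  The spectrum of a bounded self-adjoint operator is a nonempty compact set of real numbers; below
  its real points are taken as a set of reals, in order to form the supremum.
\<close>

definition sup_spectrum :: "(('a \<Rightarrow> complex) \<Rightarrow> ('a \<Rightarrow> complex)) \<Rightarrow> real" where
  "sup_spectrum T = Sup {r. complex_of_real r \<in> ell2_spectrum T}"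

end

theory Submission
  imports Defs
begin

text \<open>
  Let \<open>M\<close> be the supremum of the quadratic form \<open>\<langle>\<H> f, f\<rangle>\<close> over unit vectors; it is the top of the
  spectrum. The product trial function \<open>\<phi> \<otimes> \<phi>\<close> shows that the one-particle form
  \<open>(\<kappa> + \<rho>) \<Delta> + \<gamma> \<delta>\<^sub>0\<close> is bounded by \<open>M / 2\<close>. Replacing \<open>f\<close> by the norms of its fibers bounds
  \<open>\<A>\<^sup>2 + \<gamma> \<delta>\<^sub>0(x\<^sub>i)\<close> by \<open>M / 2\<close> as well, and a localization with two slowly varying cut-offs gives
  \<open>\<langle>\<H> f, f\<rangle> \<le> (M / 2 + \<epsilon>) \<parallel>f\<parallel>\<^sup>2 + \<gamma> \<Sum>\<^sub>F |f|\<^sup>2\<close> with \<open>F\<close> finite. If \<open>M > 0\<close>, then \<open>M / 2 + \<epsilon> < M\<close>, so a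
  sequence of unit vectors whose forms converge to \<open>M\<close> is Cauchy as soon as it converges on \<open>F\<close>.
  Applied to a maximizing sequence this yields an eigenvector; applied to the eigenvectors of
  eigenvalues accumulating at \<open>M\<close> it contradicts their orthogonality to the limit. Finally,
  \<open>|f|\<close> is an eigenfunction for \<open>M\<close> whenever \<open>f\<close> is, and a nonnegative eigenfunction with a zero
  vanishes identically because the lattice is connected; this gives positivity and simplicity.
\<close>

section \<open>The Hilbert space type\<close>

typedef 'a l2 = "ell2 :: ('a \<Rightarrow> complex) set"
  morphisms l2_fun to_l2
  by (rule exI[of _ "\<lambda>_. 0"]) (simp add: ell2_def)

section \<open>Closure properties of square summable functions\<close>

lemma ell2_summable_mult:
  assumes "f \<in> ell2" "g \<in> ell2"
  shows "(\<lambda>x. cmod (f x) * cmod (g x)) summable_on UNIV"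
proof (rule summable_on_comparison_test)
  show "(\<lambda>x. (cmod (f x))\<^sup>2 + (cmod (g x))\<^sup>2) summable_on UNIV"
    using assms by (intro summable_on_add) (auto simp: ell2_def)
  show "cmod (f x) * cmod (g x) \<le> (cmod (f x))\<^sup>2 + (cmod (g x))\<^sup>2" for x
    using sum_squares_bound[of "cmod (f x)" "cmod (g x)"]
      mult_nonneg_nonneg[OF norm_ge_zero[of "f x"] norm_ge_zero[of "g x"]] by linarith
qed auto

lemma ell2_summable_inner:
  assumes "f \<in> ell2" "g \<in> ell2"
  shows "(\<lambda>x. f x \<bullet> g x) summable_on UNIV"
proof (rule abs_summable_summable)
  show "(\<lambda>x. norm (f x \<bullet> g x)) summable_on UNIV"
    by (rule summable_on_comparison_test[OF ell2_summable_mult[OF assms]])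
      (auto intro: Cauchy_Schwarz_ineq2)
qed

lemma ell2_bounded_mult:
  assumes "f \<in> ell2" "\<And>x. cmod (g x) \<le> C * cmod (f x)"
  shows "g \<in> ell2"
proof -
  have "(\<lambda>x. C\<^sup>2 * (cmod (f x))\<^sup>2) summable_on UNIV"
    using assms(1) by (intro summable_on_cmult_right) (auto simp: ell2_def)
  moreover have "(cmod (g x))\<^sup>2 \<le> C\<^sup>2 * (cmod (f x))\<^sup>2" for x
    using power_mono[OF assms(2) norm_ge_zero, of x 2] by (simp add: power_mult_distrib)
  ultimately show ?thesis
    unfolding ell2_def mem_Collect_eq by (rule summable_on_comparison_test) auto
qed

lemma ell2_add:
  assumes "f \<in> ell2" "g \<in> ell2"
  shows "(\<lambda>x. f x + g x) \<in> ell2"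
proof -
  have "(\<lambda>x. 2 * (cmod (f x))\<^sup>2 + 2 * (cmod (g x))\<^sup>2) summable_on UNIV"
    using assms by (intro summable_on_add summable_on_cmult_right) (auto simp: ell2_def)
  moreover have "(cmod (f x + g x))\<^sup>2 \<le> 2 * (cmod (f x))\<^sup>2 + 2 * (cmod (g x))\<^sup>2" for x
  proof -
    have "(cmod (f x + g x))\<^sup>2 \<le> (cmod (f x) + cmod (g x))\<^sup>2"
      by (rule power_mono[OF norm_triangle_ineq]) simp
    then show ?thesis
      using sum_squares_bound[of "cmod (f x)" "cmod (g x)"] by (simp add: power2_sum)
  qed
  ultimately show ?thesis
    unfolding ell2_def mem_Collect_eq by (rule summable_on_comparison_test) auto
qed

lemma ell2_cmult: "f \<in> ell2 \<Longrightarrow> (\<lambda>x. c * f x) \<in> ell2"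
  by (rule ell2_bounded_mult[where C = "cmod c"]) (auto simp: norm_mult)

lemma ell2_diff: "f \<in> ell2 \<Longrightarrow> g \<in> ell2 \<Longrightarrow> (\<lambda>x. f x - g x) \<in> ell2"
  using ell2_add[of f "\<lambda>x. - 1 * g x"] ell2_cmult[of g "-1"] by simp

lemma l2_fun_ell2 [simp]: "l2_fun f \<in> ell2"
  by (rule l2_fun)

lemma l2_eqI: "(\<And>x. l2_fun f x = l2_fun g x) \<Longrightarrow> f = g"
  by (metis ext l2_fun_inject)

text \<open>The inner product is the real part of the Hermitian one and induces the same norm. This
  makes the theory of real inner product spaces available; multiplication by a complex scalar is
  treated as the operator \<open>lmult (\<lambda>_. c)\<close>.\<close>

instantiation l2 :: (type) real_inner
begin

definition "0 = to_l2 (\<lambda>_. 0)"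
definition "f + g = to_l2 (\<lambda>x. l2_fun f x + l2_fun g x)"
definition "f - g = to_l2 (\<lambda>x. l2_fun f x - l2_fun g x)"
definition "- f = to_l2 (\<lambda>x. - l2_fun f x)"
definition "r *\<^sub>R f = to_l2 (\<lambda>x. r *\<^sub>R l2_fun f x)"
definition "f \<bullet> g = (\<Sum>\<^sub>\<infinity>x. l2_fun f x \<bullet> l2_fun g x)"
definition "norm f = ell2_norm (l2_fun f)"
definition "dist f g = norm (f - g :: 'a l2)"
definition "sgn (f :: 'a l2) = inverse (norm f) *\<^sub>R f"
definition [code del]:
  "(uniformity :: ('a l2 \<times> 'a l2) filter) = (INF e\<in>{0 <..}. principal {(x, y). dist x y < e})"
definition [code del]:
  "open (U :: 'a l2 set) \<longleftrightarrow> (\<forall>x\<in>U. eventually (\<lambda>(x', y). x' = x \<longrightarrow> y \<in> U) uniformity)"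

lemma l2_fun_zero [simp]: "l2_fun 0 x = 0"
  by (simp add: zero_l2_def to_l2_inverse ell2_def)

lemma l2_fun_add [simp]: "l2_fun (f + g) x = l2_fun f x + l2_fun g x"
  by (simp add: plus_l2_def to_l2_inverse ell2_add)

lemma l2_fun_diff [simp]: "l2_fun (f - g) x = l2_fun f x - l2_fun g x"
  by (simp add: minus_l2_def to_l2_inverse ell2_diff)

lemma l2_fun_uminus [simp]: "l2_fun (- f) x = - l2_fun f x"
  using ell2_cmult[of "l2_fun f" "-1"] by (simp add: uminus_l2_def to_l2_inverse)

lemma l2_fun_scaleR [simp]: "l2_fun (r *\<^sub>R f) x = r *\<^sub>R l2_fun f x"
  using ell2_cmult[of "l2_fun f" "of_real r"]
  by (simp add: scaleR_l2_def to_l2_inverse scaleR_conv_of_real)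

instance
proof
  fix f g h :: "'a l2" and r s :: real
  show "dist f g = norm (f - g)" by (rule dist_l2_def)
  show "sgn f = inverse (norm f) *\<^sub>R f" by (rule sgn_l2_def)
  show "uniformity = (INF e\<in>{0 <..}. principal {(x :: 'a l2, y). dist x y < e})"
    by (rule uniformity_l2_def)
  show "open U \<longleftrightarrow> (\<forall>x\<in>U. eventually (\<lambda>(x', y). x' = x \<longrightarrow> y \<in> U) uniformity)" for U :: "'a l2 set"
    by (rule open_l2_def)
  show "f + g + h = f + (g + h)" "f + g = g + f" "0 + f = f" "- f + f = 0" "f - g = f + - g"
    "r *\<^sub>R (f + g) = r *\<^sub>R f + r *\<^sub>R g" "(r + s) *\<^sub>R f = r *\<^sub>R f + s *\<^sub>R f"
    "r *\<^sub>R s *\<^sub>R f = (r * s) *\<^sub>R f" "1 *\<^sub>R f = f"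
    by (auto intro!: l2_eqI simp: algebra_simps)
  show "f \<bullet> g = g \<bullet> f"
    by (simp add: inner_l2_def inner_commute)
  show "(f + g) \<bullet> h = f \<bullet> h + g \<bullet> h"
    by (simp add: inner_l2_def inner_add_left infsum_add ell2_summable_inner)
  show "r *\<^sub>R f \<bullet> g = r * (f \<bullet> g)"
    by (simp add: inner_l2_def infsum_cmult_right ell2_summable_inner)
  show "0 \<le> f \<bullet> f"
    unfolding inner_l2_def by (rule infsum_nonneg) simp
  show "(f \<bullet> f = 0) = (f = 0)"
  proof
    assume "f \<bullet> f = 0"
    then have "l2_fun f x \<bullet> l2_fun f x = 0" for x
      by (intro nonneg_infsum_le_0D[of "\<lambda>x. l2_fun f x \<bullet> l2_fun f x" UNIV x])
        (auto simp: inner_l2_def ell2_summable_inner)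
    then show "f = 0" by (intro l2_eqI) simp
  qed (simp add: inner_l2_def)
  show "norm f = sqrt (f \<bullet> f)"
    by (simp add: norm_l2_def ell2_norm_def inner_l2_def power2_norm_eq_inner)
qed

end

lemma l2_fun_sum [simp]: "l2_fun (\<Sum>i\<in>A. f i) x = (\<Sum>i\<in>A. l2_fun (f i) x)"
  by (induction A rule: infinite_finite_induct) auto

lemma l2_norm_sq: "(norm f)\<^sup>2 = (\<Sum>\<^sub>\<infinity>x. (cmod (l2_fun f x))\<^sup>2)"
  by (simp add: power2_norm_eq_inner inner_l2_def)

lemma l2_summable_sq: "(\<lambda>x. (cmod (l2_fun f x))\<^sup>2) summable_on UNIV"
  using l2_fun_ell2[of f] unfolding ell2_def by blast

lemma l2_sum_sq_le: "finite A \<Longrightarrow> (\<Sum>x\<in>A. (cmod (l2_fun f x))\<^sup>2) \<le> (norm f)\<^sup>2"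
  unfolding l2_norm_sq by (rule finite_sum_le_infsum) (auto simp: l2_summable_sq)

lemma l2_apply_le: "cmod (l2_fun f x) \<le> norm f"
  using l2_sum_sq_le[of "{x}" f] by (simp add: power2_le_iff_abs_le)

lemma bounded_linear_l2_apply: "bounded_linear (\<lambda>f. l2_fun f x)"
  by (rule bounded_linear_intro[where K = 1]) (auto simp: l2_apply_le)

text \<open>A Cauchy sequence converges in each coordinate. Sums of squared differences over a
  finite set survive the limit in one index, and a bound uniform in the finite set yields both
  membership of the limit in \<open>ell2\<close> and convergence in norm.\<close>

instance l2 :: (type) complete_space
proof
  fix X :: "nat \<Rightarrow> 'a l2"
  assume C: "Cauchy X"
  have "Cauchy (\<lambda>n. l2_fun (X n) x)" for x
    by (rule bounded_linear.Cauchy[OF bounded_linear_l2_apply C])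
  then have "\<exists>g. \<forall>x. (\<lambda>n. l2_fun (X n) x) \<longlonglongrightarrow> g x"
    by (intro choice allI) (auto simp: Cauchy_convergent_iff convergent_def)
  then obtain g where g: "\<And>x. (\<lambda>n. l2_fun (X n) x) \<longlonglongrightarrow> g x" by blast
  have bound: "\<exists>N. \<forall>n\<ge>N. \<forall>A. finite A \<longrightarrow> (\<Sum>x\<in>A. (cmod (l2_fun (X n) x - g x))\<^sup>2) \<le> e\<^sup>2"
    if "e > 0" for e
  proof -
    obtain N where N: "\<And>m n. m \<ge> N \<Longrightarrow> n \<ge> N \<Longrightarrow> norm (X m - X n) < e"
      using C \<open>e > 0\<close> unfolding Cauchy_def dist_norm by meson
    show ?thesis
    proof (intro exI[of _ N] allI impI)
      fix n and A :: "'a set"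
      assume n: "n \<ge> N" and A: "finite A"
      have "(\<lambda>m. \<Sum>x\<in>A. (cmod (l2_fun (X n) x - l2_fun (X m) x))\<^sup>2)
          \<longlonglongrightarrow> (\<Sum>x\<in>A. (cmod (l2_fun (X n) x - g x))\<^sup>2)"
        by (intro tendsto_intros g)
      moreover have "(\<Sum>x\<in>A. (cmod (l2_fun (X n) x - l2_fun (X m) x))\<^sup>2) \<le> e\<^sup>2" if "m \<ge> N" for m
        using l2_sum_sq_le[OF A, of "X n - X m"] power_mono[OF less_imp_le[OF N[OF n that]] norm_ge_zero, of 2]
        by simp
      ultimately show "(\<Sum>x\<in>A. (cmod (l2_fun (X n) x - g x))\<^sup>2) \<le> e\<^sup>2"
        by (intro LIMSEQ_le_const2) auto
    qed
  qed
  obtain N where N: "\<And>A. finite A \<Longrightarrow> (\<Sum>x\<in>A. (cmod (l2_fun (X N) x - g x))\<^sup>2) \<le> 1\<^sup>2"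
    using bound[of 1] by auto
  have "(\<lambda>x. l2_fun (X N) x - g x) \<in> ell2"
    unfolding ell2_def mem_Collect_eq
    by (rule nonneg_bounded_partial_sums_imp_summable_on[where C = 1])
      (use N in \<open>auto simp: eventually_finite_subsets_at_top\<close>)
  from ell2_diff[OF l2_fun_ell2[of "X N"] this] have gl: "g \<in> ell2" by simp
  define G where "G = to_l2 g"
  have G: "l2_fun G x = g x" for x by (simp add: G_def to_l2_inverse gl)
  have "X \<longlonglongrightarrow> G"
  proof (rule metric_LIMSEQ_I)
    fix r :: real assume r: "r > 0"
    obtain N where N: "\<And>n A. n \<ge> N \<Longrightarrow> finite A \<Longrightarrow> (\<Sum>x\<in>A. (cmod (l2_fun (X n) x - g x))\<^sup>2) \<le> (r/2)\<^sup>2"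
      using bound[of "r/2"] r by auto
    have "norm (X n - G) < r" if "n \<ge> N" for n
    proof -
      have "(norm (X n - G))\<^sup>2 \<le> (r/2)\<^sup>2"
        unfolding l2_norm_sq
        by (rule infsum_le_finite_sums[OF l2_summable_sq]) (use N that in \<open>simp add: G\<close>)
      then have "norm (X n - G) \<le> r / 2" using r by (simp add: power2_le_iff_abs_le)
      with r show ?thesis by simp
    qed
    then show "\<exists>N. \<forall>n\<ge>N. dist (X n) G < r" by (auto simp: dist_norm)
  qed
  then show "convergent X" by (auto simp: convergent_def)
qed

section \<open>Symmetric operators bounded above\<close>

locale symmetric_operator =
  fixes T :: "'h::{real_inner, complete_space} \<Rightarrow> 'h" and M :: real
  assumes lin: "bounded_linear T"
    and sym: "T f \<bullet> g = f \<bullet> T g"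
    and upper: "T f \<bullet> f \<le> M * (norm f)\<^sup>2"
begin

text \<open>The quadratic form of \<open>M - T\<close>, nonnegative by \<open>upper\<close>. It
  vanishes exactly where \<open>T f = M *\<^sub>R f\<close>, and its size measures how far a vector
  is from being a maximizer.\<close>

definition gap :: "'h \<Rightarrow> real" where
  "gap f = M * (norm f)\<^sup>2 - T f \<bullet> f"

lemma gap_eq: "gap f = (M *\<^sub>R f - T f) \<bullet> f"
  by (simp add: gap_def inner_diff_left power2_norm_eq_inner)

lemma gap_nonneg: "0 \<le> gap f"
  using upper[of f] by (simp add: gap_def)

text \<open>The parallelogram identity for this form, from which the nonnegative term
  \<open>gap (f + g)\<close> is dropped.\<close>

lemma gap_diff_le: "gap (f - g) \<le> 2 * gap f + 2 * gap g"
proof -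
  interpret bounded_linear T by (rule lin)
  have "gap (f - g) + gap (f + g) = 2 * gap f + 2 * gap g"
    by (simp add: gap_def power2_norm_eq_inner add diff inner_add_left inner_add_right
        inner_diff_left inner_diff_right algebra_simps)
  then show ?thesis using gap_nonneg[of "f + g"] by linarith
qed

lemma gap_perturb:
  "gap (f + t *\<^sub>R g) = gap f + 2 * t * ((M *\<^sub>R f - T f) \<bullet> g) + t\<^sup>2 * gap g"
proof -
  interpret bounded_linear T by (rule lin)
  have "T g \<bullet> f = T f \<bullet> g" "g \<bullet> f = f \<bullet> g" "f \<bullet> T g = T f \<bullet> g" "g \<bullet> T f = T f \<bullet> g"
    by (metis sym inner_commute)+
  then show ?thesis
    by (simp add: gap_eq add scaleR inner_add_left inner_add_right
        inner_diff_left inner_diff_right algebra_simps power2_eq_square)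
qed

text \<open>The polynomial \<open>gap (f + t *\<^sub>R g)\<close> in \<open>t\<close> is nonnegative
  everywhere, so its discriminant is nonpositive. For \<open>gap g = 0\<close> it is affine and must
  have slope zero.\<close>

lemma gap_Cauchy_Schwarz: "((M *\<^sub>R f - T f) \<bullet> g)\<^sup>2 \<le> gap f * gap g"
proof -
  define b where "b = (M *\<^sub>R f - T f) \<bullet> g"
  have pos: "0 \<le> gap f + 2 * t * b + t\<^sup>2 * gap g" for t
    using gap_nonneg[of "f + t *\<^sub>R g"] unfolding gap_perturb b_def .
  show ?thesis
  proof (cases "gap g = 0")
    case True
    have "b = 0"
    proof (rule ccontr)
      assume "b \<noteq> 0"
      \<comment> \<open>This \<open>t\<close> gives the affine function the value -1.\<close>
      then show False
        using pos[of "- (gap f + 1) / (2 * b)"] True by (simp add: field_simps)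
    qed
    then show ?thesis using True by (simp flip: b_def)
  next
    case False
    then have g: "gap g > 0" using gap_nonneg[of g] by simp
    \<comment> \<open>The minimizer of the polynomial is inserted for \<open>t\<close>.\<close>
    have "0 \<le> gap f + 2 * (- b / gap g) * b + (- b / gap g)\<^sup>2 * gap g" by (rule pos)
    also have "\<dots> = gap f - b\<^sup>2 / gap g"
      using g by (simp add: field_simps power2_eq_square)
    finally show ?thesis using g by (simp add: field_simps flip: b_def)
  qed
qed

text \<open>A small gap makes a vector an approximate eigenvector. Take the defect \<open>d\<close>
  itself as the second vector in \<open>gap_Cauchy_Schwarz\<close>: the fourth power of its norm is
  at most \<open>gap f * gap d\<close>, boundedness of \<open>T\<close> controls
  \<open>gap d\<close> by the square of the norm, and this square cancels.\<close>

lemma defect_sq_le_gap: "\<exists>K. \<forall>f. (norm (M *\<^sub>R f - T f))\<^sup>2 \<le> K * gap f"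
proof -
  obtain K where K: "K > 0" "\<And>f. norm (T f) \<le> norm f * K"
    using bounded_linear.pos_bounded[OF lin] by blast
  have gap_le: "gap g \<le> (\<bar>M\<bar> + K) * (norm g)\<^sup>2" for g
  proof -
    have "- (T g \<bullet> g) \<le> norm (T g) * norm g"
      using Cauchy_Schwarz_ineq2[of "T g" g] by linarith
    also have "\<dots> \<le> norm g * K * norm g"
      by (rule mult_right_mono[OF K(2)]) simp
    finally show ?thesis
      using mult_right_mono[OF abs_ge_self[of M], of "(norm g)\<^sup>2"]
      by (simp add: gap_def algebra_simps power2_eq_square)
  qed
  have "(norm (M *\<^sub>R f - T f))\<^sup>2 \<le> (\<bar>M\<bar> + K) * gap f" for f
  proof (cases "M *\<^sub>R f = T f")
    case False
    define d where "d = M *\<^sub>R f - T f"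
    have d: "(norm d)\<^sup>2 > 0" using False by (simp add: d_def)
    have "(norm d)\<^sup>2 * (norm d)\<^sup>2 = (d \<bullet> d)\<^sup>2"
      unfolding power2_norm_eq_inner by (simp only: power2_eq_square)
    also have "\<dots> \<le> gap f * gap d"
      using gap_Cauchy_Schwarz[of f d] by (simp add: d_def)
    also have "\<dots> \<le> gap f * ((\<bar>M\<bar> + K) * (norm d)\<^sup>2)"
      by (rule mult_left_mono[OF gap_le gap_nonneg])
    also have "\<dots> = ((\<bar>M\<bar> + K) * gap f) * (norm d)\<^sup>2" by simp
    finally show ?thesis unfolding d_def[symmetric] using d by (rule mult_right_le_imp_le)
  qed (use K gap_nonneg[of f] in simp)
  then show ?thesis by blast
qed

lemma maximizer_is_eigenvector:
  assumes "T f \<bullet> f = M * (norm f)\<^sup>2"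
  shows "T f = M *\<^sub>R f"
proof -
  obtain K where "(norm (M *\<^sub>R f - T f))\<^sup>2 \<le> K * gap f"
    using defect_sq_le_gap by blast
  then show ?thesis using assms by (simp add: gap_def)
qed

text \<open>The form of \<open>z - T\<close> is at least \<open>z - M\<close>, and Cauchy-Schwarz
  turns this into a norm bound. It provides injectivity above \<open>M\<close> and the bound on the
  inverse.\<close>

lemma coercive:
  assumes "z > M"
  shows "norm f \<le> norm (T f - z *\<^sub>R f) / (z - M)"
proof (cases "f = 0")
  case False
  have "(z - M) * (norm f)\<^sup>2 \<le> - ((T f - z *\<^sub>R f) \<bullet> f)"
    using upper[of f] by (simp add: inner_diff_left power2_norm_eq_inner algebra_simps)
  also have "\<dots> \<le> norm (T f - z *\<^sub>R f) * norm f"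
    using Cauchy_Schwarz_ineq2[of "T f - z *\<^sub>R f" f] by linarith
  finally have "((z - M) * norm f) * norm f \<le> norm (T f - z *\<^sub>R f) * norm f"
    by (simp add: power2_eq_square algebra_simps)
  then have "(z - M) * norm f \<le> norm (T f - z *\<^sub>R f)"
    using False by simp
  then show ?thesis using assms by (simp add: field_simps)
qed (use assms in simp)

text \<open>For small \<open>t > 0\<close> the map \<open>f \<mapsto> f - t (z f - T f) - t g\<close> is a contraction.\<close>
lemma surj_above:
  assumes "z > M"
  shows "\<exists>f. T f - z *\<^sub>R f = g"
proof -
  interpret bounded_linear T by (rule lin)
  define B where "B f = z *\<^sub>R f - T f" for f
  obtain K where K: "K > 0" "\<And>f. norm (T f) \<le> norm f * K"
    using pos_bounded by blast
  define L where "L = \<bar>z\<bar> + K"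
  have L: "L > 0" "norm (B f) \<le> L * norm f" for f
  proof -
    show "L > 0" using K by (simp add: L_def)
    have "norm (B f) \<le> \<bar>z\<bar> * norm f + norm (T f)"
      using norm_triangle_ineq4[of "z *\<^sub>R f" "T f"] by (simp add: B_def)
    then show "norm (B f) \<le> L * norm f"
      using K(2)[of f] by (simp add: L_def algebra_simps)
  qed
  have Bd: "B (f - h) = B f - B h" for f h by (simp add: B_def diff algebra_simps)
  \<comment> \<open>The cap by \<open>L\<close> ensures that \<open>q\<close> below is
    nonnegative.\<close>
  define \<delta> where "\<delta> = min (z - M) L"
  have \<delta>: "\<delta> > 0" "\<delta> \<le> L" using assms L by (auto simp: \<delta>_def)
  have low: "B f \<bullet> f \<ge> \<delta> * (norm f)\<^sup>2" for f
  proof -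
    have "\<delta> * (norm f)\<^sup>2 \<le> (z - M) * (norm f)\<^sup>2"
      by (rule mult_right_mono) (auto simp: \<delta>_def)
    then show ?thesis
      using upper[of f] by (simp add: B_def inner_diff_left power2_norm_eq_inner algebra_simps)
  qed
  \<comment> \<open>This \<open>t\<close> minimizes
    \<open>1 - 2 * t * \<delta> + t\<^sup>2 * L\<^sup>2\<close>, and \<open>q\<close> is the
    minimum.\<close>
  define t where "t = \<delta> / L\<^sup>2"
  define q where "q = 1 - \<delta>\<^sup>2 / L\<^sup>2"
  have q: "0 \<le> q" "q < 1"
    using \<delta> L by (auto simp: q_def power_mono)
  have contr: "(norm (f - t *\<^sub>R B f))\<^sup>2 \<le> q * (norm f)\<^sup>2" for f
  proof -
    have t: "t > 0" using \<delta> L by (simp add: t_def)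
    have "(norm (f - t *\<^sub>R B f))\<^sup>2 = (norm f)\<^sup>2 - 2 * t * (B f \<bullet> f) + t\<^sup>2 * (norm (B f))\<^sup>2"
      unfolding power2_norm_eq_inner
      by (simp add: inner_diff_left inner_diff_right inner_commute[of f "B f"]
          power2_eq_square algebra_simps)
    also have "\<dots> \<le> (norm f)\<^sup>2 - 2 * t * (\<delta> * (norm f)\<^sup>2) + t\<^sup>2 * (L * norm f)\<^sup>2"
      using low t L by (intro add_mono diff_mono mult_left_mono power_mono) auto
    also have "\<dots> = (1 - 2 * t * \<delta> + t\<^sup>2 * L\<^sup>2) * (norm f)\<^sup>2"
      by (simp add: algebra_simps power2_eq_square)
    also have "1 - 2 * t * \<delta> + t\<^sup>2 * L\<^sup>2 = q"
      using L by (simp add: t_def q_def field_simps power2_eq_square)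
    finally show ?thesis .
  qed
  have "\<exists>!f. f - t *\<^sub>R B f - t *\<^sub>R g = f"
  proof (rule banach_fix_type[where c = "sqrt q"])
    show "\<forall>x y. dist (x - t *\<^sub>R B x - t *\<^sub>R g) (y - t *\<^sub>R B y - t *\<^sub>R g) \<le> sqrt q * dist x y"
    proof (intro allI)
      fix x y
      have "dist (x - t *\<^sub>R B x - t *\<^sub>R g) (y - t *\<^sub>R B y - t *\<^sub>R g) = norm ((x - y) - t *\<^sub>R B (x - y))"
        by (simp add: dist_norm Bd algebra_simps)
      also have "\<dots> \<le> sqrt (q * (norm (x - y))\<^sup>2)"
        using contr[of "x - y"] by (rule real_le_rsqrt)
      also have "\<dots> = sqrt q * dist x y" by (simp add: real_sqrt_mult dist_norm)
      finally show "dist (x - t *\<^sub>R B x - t *\<^sub>R g) (y - t *\<^sub>R B y - t *\<^sub>R g) \<le> sqrt q * dist x y" .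
    qed
  qed (use q in auto)
  then obtain f where f: "f - t *\<^sub>R B f - t *\<^sub>R g = f" by blast
  have t0: "t \<noteq> 0" using \<delta> L by (simp add: t_def)
  from f have "t *\<^sub>R (B f + g) = 0" by (simp add: algebra_simps)
  with t0 have "B f + g = 0" by simp
  then have "T f - z *\<^sub>R f = g" by (simp add: B_def algebra_simps)
  then show ?thesis ..
qed

end

section \<open>Compactness of maximizing sequences\<close>

text \<open>Bolzano-Weierstrass in one coordinate after another, refining the subsequence at each
  point of \<open>F\<close>.\<close>

lemma finite_pointwise_convergent_subseq:
  fixes X :: "nat \<Rightarrow> 'a \<Rightarrow> complex"
  assumes "finite F" "\<And>n x. cmod (X n x) \<le> K"
  shows "\<exists>r. strict_mono r \<and> (\<forall>x\<in>F. convergent (\<lambda>n. X (r n) x))"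
  using assms(1)
proof (induction F)
  case empty
  then show ?case using strict_mono_id by blast
next
  case (insert a F)
  then obtain r where r: "strict_mono r" "\<forall>x\<in>F. convergent (\<lambda>n. X (r n) x)" by blast
  have "bounded (range (\<lambda>n. X (r n) a))"
    using assms(2) by (auto simp: bounded_iff)
  then obtain l s where s: "strict_mono s" "((\<lambda>n. X (r n) a) \<circ> s) \<longlonglongrightarrow> l"
    using bounded_imp_convergent_subsequence by blast
  have "convergent (\<lambda>n. X ((r \<circ> s) n) x)" if "x \<in> insert a F" for x
  proof (cases "x = a")
    case True
    then show ?thesis using s(2) by (auto simp: convergent_def o_def)
  next
    case False
    then have "convergent ((\<lambda>n. X (r n) x) \<circ> s)"
      using that r(2) s(1) by (auto intro: convergent_subseq_convergent)
    then show ?thesis by (simp add: o_def)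
  qed
  moreover have "strict_mono (r \<circ> s)" using r(1) s(1) by (rule strict_mono_o)
  ultimately show ?case by blast
qed

text \<open>An upper bound strictly below \<open>M\<close> up to a finitely supported potential replaces the
  statement that the essential spectrum lies strictly below \<open>M\<close>.\<close>
lemma maximizing_sequence_convergent:
  fixes T :: "'a l2 \<Rightarrow> 'a l2"
  assumes "symmetric_operator T M" and "finite F" and "\<delta> > 0"
    and ess: "\<And>f. T f \<bullet> f \<le> (M - \<delta>) * (norm f)\<^sup>2 + C * (\<Sum>x\<in>F. (cmod (l2_fun f x))\<^sup>2)"
    and unit: "\<And>n. norm (X n) = 1" and max: "(\<lambda>n. T (X n) \<bullet> X n) \<longlonglongrightarrow> M"
  shows "\<exists>f r. strict_mono r \<and> (X \<circ> r) \<longlonglongrightarrow> f \<and> norm f = 1 \<and> T f = M *\<^sub>R f"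
proof -
  interpret symmetric_operator T M by fact
  have "cmod (l2_fun (X n) x) \<le> 1" for n x
    using l2_apply_le[of "X n" x] unit by simp
  from finite_pointwise_convergent_subseq[OF assms(2), of "\<lambda>n. l2_fun (X n)", OF this]
  obtain r where r: "strict_mono r" "\<forall>x\<in>F. convergent (\<lambda>n. l2_fun (X (r n)) x)" by blast
  define Y where "Y = X \<circ> r"
  define S where "S f = (\<Sum>x\<in>F. (cmod (l2_fun f x))\<^sup>2)" for f :: "'a l2"
  have gapY: "(\<lambda>n. gap (Y n)) \<longlonglongrightarrow> 0"
  proof -
    have "(\<lambda>n. gap (X n)) \<longlonglongrightarrow> M - M"
      unfolding gap_def unit power_one mult_1_right by (intro tendsto_intros max)
    then show ?thesis
      using LIMSEQ_subseq_LIMSEQ[OF _ r(1)] by (auto simp: Y_def o_def)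
  qed
  \<comment> \<open>For \<open>d = Y m - Y n\<close>, the hypothesis \<open>ess\<close> says that
    \<open>\<delta> * (norm d)\<^sup>2\<close> is at most \<open>gap d + C * S d\<close>; the
    parallelogram bound splits \<open>gap d\<close> into gaps that tend to zero.\<close>
  have main: "\<delta> * (norm (Y m - Y n))\<^sup>2 \<le> 2 * gap (Y m) + 2 * gap (Y n) + C * S (Y m - Y n)" for m n
    using ess[of "Y m - Y n"] gap_diff_le[of "Y m" "Y n"]
    unfolding gap_def S_def by (simp add: algebra_simps)
  have "Cauchy Y"
  proof (rule metric_CauchyI)
    fix e :: real assume e: "e > 0"
    have "\<exists>L. \<forall>x\<in>F. (\<lambda>n. l2_fun (Y n) x) \<longlonglongrightarrow> L x"
      using r(2) by (intro bchoice) (auto simp: Y_def convergent_def)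
    then obtain L where L: "\<And>x. x \<in> F \<Longrightarrow> (\<lambda>n. l2_fun (Y n) x) \<longlonglongrightarrow> L x" by blast
    \<comment> \<open>\<open>W\<close> measures the distance to the pointwise limits on
      \<open>F\<close> only, which is all that the potential term sees.\<close>
    define W where "W n = (\<Sum>x\<in>F. (cmod (l2_fun (Y n) x - L x))\<^sup>2)" for n
    have "W \<longlonglongrightarrow> (\<Sum>x\<in>F. (cmod (L x - L x))\<^sup>2)"
      unfolding W_def by (intro tendsto_intros L)
    then have W0: "W \<longlonglongrightarrow> 0" by simp
    have SW: "S (Y m - Y n) \<le> 2 * W m + 2 * W n" for m n
    proof -
      have *: "(cmod (a - b))\<^sup>2 \<le> 2 * (cmod (a - c))\<^sup>2 + 2 * (cmod (b - c))\<^sup>2" for a b c :: complex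
      proof -
        have "cmod (a - b) \<le> cmod (a - c) + cmod (b - c)"
          using norm_triangle_ineq4[of "a - c" "b - c"] by simp
        then have "(cmod (a - b))\<^sup>2 \<le> (cmod (a - c) + cmod (b - c))\<^sup>2"
          by (rule power_mono) simp
        then show ?thesis
          using sum_squares_bound[of "cmod (a - c)" "cmod (b - c)"] by (simp add: power2_sum)
      qed
      show ?thesis
        unfolding S_def W_def sum_distrib_left l2_fun_diff
        by (simp flip: sum.distrib) (intro sum_mono *)
    qed
    define G where "G n = 2 * gap (Y n) + 2 * \<bar>C\<bar> * W n" for n
    have "G \<longlonglongrightarrow> 2 * 0 + 2 * \<bar>C\<bar> * 0"
      unfolding G_def by (intro tendsto_intros gapY W0)
    then have "\<forall>\<^sub>F n in sequentially. G n < \<delta> * e\<^sup>2 / 2"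
      using e assms(3) by (intro order_tendstoD(2)) auto
    then obtain N where N: "\<And>n. n \<ge> N \<Longrightarrow> G n < \<delta> * e\<^sup>2 / 2"
      by (auto simp: eventually_sequentially)
    have "dist (Y m) (Y n) < e" if "m \<ge> N" "n \<ge> N" for m n
    proof -
      have "S (Y m - Y n) \<ge> 0" by (auto simp: S_def sum_nonneg)
      then have "C * S (Y m - Y n) \<le> \<bar>C\<bar> * S (Y m - Y n)"
        by (intro mult_right_mono) auto
      also have "\<dots> \<le> \<bar>C\<bar> * (2 * W m + 2 * W n)"
        by (intro mult_left_mono SW) auto
      finally have "\<delta> * (norm (Y m - Y n))\<^sup>2 \<le> G m + G n"
        using main[of m n] by (simp add: G_def algebra_simps)
      also have "\<dots> < \<delta> * e\<^sup>2" using N[OF that(1)] N[OF that(2)] by simp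
      finally have "(norm (Y m - Y n))\<^sup>2 < e\<^sup>2" using assms(3) by simp
      then show ?thesis using e by (simp add: dist_norm power2_less_imp_less)
    qed
    then show "\<exists>N. \<forall>m\<ge>N. \<forall>n\<ge>N. dist (Y m) (Y n) < e" by blast
  qed
  then obtain f where f: "Y \<longlonglongrightarrow> f" by (auto simp: Cauchy_convergent_iff convergent_def)
  have "(\<lambda>n. norm (Y n)) \<longlonglongrightarrow> norm f" by (intro tendsto_intros f)
  moreover have "norm (Y n) = 1" for n by (simp add: Y_def unit)
  ultimately have nf: "norm f = 1" by (simp add: LIMSEQ_const_iff)
  have "(\<lambda>n. T (Y n)) \<longlonglongrightarrow> T f" by (rule bounded_linear.tendsto[OF lin f])
  \<comment> \<open>Continuity of the gap along the norm limit makes \<open>f\<close> an exact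
    maximizer.\<close>
  then have "(\<lambda>n. gap (Y n)) \<longlonglongrightarrow> gap f"
    unfolding gap_def by (intro tendsto_intros f)
  with gapY have "gap f = 0" by (rule LIMSEQ_unique[symmetric])
  then have "T f = M *\<^sub>R f" by (intro maximizer_is_eigenvector) (simp add: gap_def)
  then show ?thesis using r(1) f nf unfolding Y_def by blast
qed

section \<open>Shifts and multiplication operators\<close>

definition shift :: "'a::ab_group_add \<Rightarrow> 'a l2 \<Rightarrow> 'a l2" where
  "shift s f = to_l2 (\<lambda>x. l2_fun f (x + s))"

lemma infsum_translate:
  fixes a :: "'a::ab_group_add \<Rightarrow> real"
  shows "(\<Sum>\<^sub>\<infinity>x. a (x + s)) = (\<Sum>\<^sub>\<infinity>x. a x)"
  by (rule infsum_reindex_bij_witness[where i = "\<lambda>x. x - s" and j = "\<lambda>x. x + s"]) auto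

lemma l2_fun_shift [simp]: "l2_fun (shift s f) x = l2_fun f (x + s)"
proof -
  have "(\<lambda>x. (cmod (l2_fun f (x + s)))\<^sup>2) summable_on UNIV \<longleftrightarrow> (\<lambda>x. (cmod (l2_fun f x))\<^sup>2) summable_on UNIV"
    by (rule summable_on_reindex_bij_witness[where i = "\<lambda>x. x - s" and j = "\<lambda>x. x + s"]) auto
  then have "(\<lambda>x. l2_fun f (x + s)) \<in> ell2"
    using l2_summable_sq[of f] by (simp add: ell2_def)
  then show ?thesis by (simp add: shift_def to_l2_inverse)
qed

lemma norm_shift [simp]: "norm (shift s f) = norm f"
proof -
  have "(norm (shift s f))\<^sup>2 = (norm f)\<^sup>2"
    using infsum_translate[of "\<lambda>x. (cmod (l2_fun f x))\<^sup>2" s] by (simp add: l2_norm_sq)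
  then show ?thesis by simp
qed

lemma shift_inner: "shift s f \<bullet> g = f \<bullet> shift (- s) g"
  using infsum_translate[of "\<lambda>x. l2_fun f x \<bullet> l2_fun g (x - s)" s] by (simp add: inner_l2_def)

lemma bounded_linear_shift: "bounded_linear (shift s)"
  by (rule bounded_linear_intro[where K = 1]) (auto intro!: l2_eqI)

text \<open>Meaningful for bounded \<open>v\<close>: otherwise the product may leave
  \<open>ell2\<close>, where \<open>to_l2\<close> is unspecified. Hence the bound \<open>K\<close>
  in the facts that follow.\<close>

definition lmult :: "('a \<Rightarrow> complex) \<Rightarrow> 'a l2 \<Rightarrow> 'a l2" where
  "lmult v f = to_l2 (\<lambda>x. v x * l2_fun f x)"

lemma l2_fun_lmult:
  assumes "\<And>x. cmod (v x) \<le> K"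
  shows "l2_fun (lmult v f) x = v x * l2_fun f x"
proof -
  have "(\<lambda>x. v x * l2_fun f x) \<in> ell2"
    by (rule ell2_bounded_mult[OF l2_fun_ell2[of f], where C = K])
      (simp add: norm_mult mult_right_mono assms)
  then show ?thesis by (simp add: lmult_def to_l2_inverse)
qed

lemma bounded_linear_lmult:
  assumes "\<And>x. cmod (v x) \<le> K"
  shows "bounded_linear (lmult v)"
proof (rule bounded_linear_intro[where K = K])
  fix f :: "'a l2"
  have K: "0 \<le> K" using norm_ge_zero assms by (rule order_trans)
  have "(norm (lmult v f))\<^sup>2 \<le> (\<Sum>\<^sub>\<infinity>x. K\<^sup>2 * (cmod (l2_fun f x))\<^sup>2)"
    unfolding l2_norm_sq
    by (intro infsum_mono l2_summable_sq summable_on_cmult_right)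
      (auto simp: l2_fun_lmult[OF assms] norm_mult power_mult_distrib intro!: mult_right_mono power_mono assms)
  also have "\<dots> = (norm f * K)\<^sup>2"
    by (simp add: infsum_cmult_right l2_summable_sq l2_norm_sq power_mult_distrib)
  finally show "norm (lmult v f) \<le> norm f * K" using K by (simp add: power2_le_iff_abs_le)
qed (auto intro!: l2_eqI simp: l2_fun_lmult[OF assms] algebra_simps)

lemma lmult_inner:
  assumes "\<And>x. cmod (v x) \<le> K" "\<And>x. v x \<in> \<real>"
  shows "lmult v f \<bullet> g = f \<bullet> lmult v g"
proof -
  have "(a * b) \<bullet> c = b \<bullet> (a * c)" if "a \<in> \<real>" for a b c :: complex
    using that by (auto elim!: Reals_cases simp: inner_complex_def algebra_simps)
  then show ?thesis using assms(2) by (simp add: inner_l2_def l2_fun_lmult[OF assms(1)])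
qed

text \<open>The hopping energy in direction \<open>s\<close>; the form of
  \<open>\<A>\<^sup>2\<close> is a combination of the nonpositive terms
  \<open>shift_form s f - (norm f)\<^sup>2\<close>.\<close>

definition shift_form :: "'a::ab_group_add \<Rightarrow> 'a l2 \<Rightarrow> real" where
  "shift_form s f = shift s f \<bullet> f"

lemma shift_form_eq: "shift_form s f = (\<Sum>\<^sub>\<infinity>x. l2_fun f (x + s) \<bullet> l2_fun f x)"
  by (simp add: shift_form_def inner_l2_def)

lemma shift_form_summable:
  fixes f :: "'a::ab_group_add l2"
  shows "(\<lambda>x. l2_fun f (x + s) \<bullet> l2_fun f x) summable_on UNIV"
  using ell2_summable_inner[of "l2_fun (shift s f)" "l2_fun f"] by simp

lemma shift_form_le: "shift_form s f \<le> (norm f)\<^sup>2"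
  using norm_cauchy_schwarz[of "shift s f" f] by (simp add: shift_form_def power2_eq_square)

definition mass :: "'a set \<Rightarrow> 'a l2 \<Rightarrow> real" where
  "mass A f = (\<Sum>\<^sub>\<infinity>x. indicator A x * (cmod (l2_fun f x))\<^sup>2)"

lemma mass_summable: "(\<lambda>x. indicator A x * (cmod (l2_fun f x))\<^sup>2) summable_on UNIV"
  by (rule summable_on_comparison_test[OF l2_summable_sq[of f]]) (auto simp: indicator_def)

lemma mass_le_finite:
  assumes "finite F" "\<And>x. x \<in> A \<Longrightarrow> x \<notin> F \<Longrightarrow> l2_fun g x = 0"
    and "\<And>x. cmod (l2_fun g x) \<le> cmod (l2_fun f x)"
  shows "mass A g \<le> (\<Sum>x\<in>F. (cmod (l2_fun f x))\<^sup>2)"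
proof -
  have "mass A g \<le> (\<Sum>\<^sub>\<infinity>x\<in>F. (cmod (l2_fun f x))\<^sup>2)"
    unfolding mass_def
    by (rule infsum_mono_neutral[OF mass_summable])
      (use assms in \<open>auto simp: indicator_def power_mono\<close>)
  then show ?thesis using assms(1) by simp
qed

lemma mass_zero: "(\<And>x. x \<in> A \<Longrightarrow> l2_fun f x = 0) \<Longrightarrow> mass A f = 0"
  unfolding mass_def by (rule infsum_0) (auto simp: indicator_def)

lemma mass_inner:
  "lmult (indicator A) f \<bullet> f = mass A f"
proof -
  have "cmod (indicator A x) \<le> 1" for x by (auto simp: indicator_def)
  from l2_fun_lmult[of "indicator A", OF this] show ?thesis
    by (auto simp: inner_l2_def mass_def indicator_def power2_norm_eq_inner intro!: infsum_cong)
qed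

section \<open>Product spaces\<close>

definition fiber :: "('b \<times> 'c) l2 \<Rightarrow> 'b \<Rightarrow> 'c l2" where
  "fiber f y = to_l2 (\<lambda>z. l2_fun f (y, z))"

lemma infsum_prod_UNIV:
  fixes a :: "'b \<times> 'c \<Rightarrow> real"
  assumes "a summable_on UNIV"
  shows "(\<Sum>\<^sub>\<infinity>y. \<Sum>\<^sub>\<infinity>z. a (y, z)) = (\<Sum>\<^sub>\<infinity>x. a x)"
    and "(\<lambda>y. \<Sum>\<^sub>\<infinity>z. a (y, z)) summable_on UNIV"
    and "(\<lambda>z. a (y, z)) summable_on UNIV"
proof -
  have a: "a summable_on (Sigma UNIV (\<lambda>_. UNIV))" using assms by simp
  show "(\<Sum>\<^sub>\<infinity>y. \<Sum>\<^sub>\<infinity>z. a (y, z)) = (\<Sum>\<^sub>\<infinity>x. a x)"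
    using infsum_Sigma_banach[OF a] by simp
  show "(\<lambda>y. \<Sum>\<^sub>\<infinity>z. a (y, z)) summable_on UNIV"
    using summable_on_Sigma_banach[of "\<lambda>y z. a (y, z)" UNIV "\<lambda>_. UNIV"] assms by simp
  have "a summable_on (Pair y ` UNIV)"
    by (rule summable_on_subset_banach[OF assms]) simp
  then show "(\<lambda>z. a (y, z)) summable_on UNIV"
    by (subst (asm) summable_on_reindex) (auto simp: inj_on_def o_def)
qed

lemma l2_fun_fiber [simp]: "l2_fun (fiber f y) z = l2_fun f (y, z)"
proof -
  have "(\<lambda>z. l2_fun f (y, z)) \<in> ell2"
    unfolding ell2_def mem_Collect_eq by (rule infsum_prod_UNIV(3)[OF l2_summable_sq])
  then show ?thesis by (simp add: fiber_def to_l2_inverse)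
qed

text \<open>Collapses the second coordinate, which reduces forms of two particles to forms of one.
  By Fubini the total norm is preserved.\<close>

definition fiber_norm :: "('b \<times> 'c) l2 \<Rightarrow> 'b l2" where
  "fiber_norm f = to_l2 (\<lambda>y. of_real (norm (fiber f y)))"

lemma fiber_norm_sq: "(norm (fiber f y))\<^sup>2 = (\<Sum>\<^sub>\<infinity>z. (cmod (l2_fun f (y, z)))\<^sup>2)"
  by (simp add: l2_norm_sq)

lemma l2_fun_fiber_norm [simp]: "l2_fun (fiber_norm f) y = of_real (norm (fiber f y))"
proof -
  have "(\<lambda>y. of_real (norm (fiber f y))) \<in> ell2"
    using infsum_prod_UNIV(2)[OF l2_summable_sq[of f]] by (simp add: ell2_def fiber_norm_sq)
  then show ?thesis by (simp add: fiber_norm_def to_l2_inverse)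
qed

lemma norm_fiber_norm: "(norm (fiber_norm f))\<^sup>2 = (norm f)\<^sup>2"
  unfolding l2_norm_sq l2_fun_fiber_norm
  using infsum_prod_UNIV(1)[OF l2_summable_sq[of f]] by (simp add: fiber_norm_sq)

text \<open>Sum over fibers first. Within a fiber the shift by \<open>c\<close> is an isometry, so
  Cauchy-Schwarz bounds the inner product by a product of fiber norms in which \<open>c\<close> no
  longer appears.\<close>

lemma shift_form_le_fiber_norm:
  fixes f :: "('b::ab_group_add \<times> 'c::ab_group_add) l2"
  shows "shift_form (e, c) f \<le> shift_form e (fiber_norm f)"
proof -
  have s: "(\<Sum>\<^sub>\<infinity>z. l2_fun f ((y, z) + (e, c)) \<bullet> l2_fun f (y, z)) = shift c (fiber f (y + e)) \<bullet> fiber f y" for y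
    by (simp add: inner_l2_def)
  have r: "l2_fun (fiber_norm f) (y + e) \<bullet> l2_fun (fiber_norm f) y = norm (fiber f (y + e)) * norm (fiber f y)" for y
    by (simp add: inner_complex_def)
  have "shift_form (e, c) f = (\<Sum>\<^sub>\<infinity>y. shift c (fiber f (y + e)) \<bullet> fiber f y)"
    unfolding shift_form_eq infsum_prod_UNIV(1)[OF shift_form_summable[of f "(e, c)"], symmetric] s ..
  also have "\<dots> \<le> (\<Sum>\<^sub>\<infinity>y. norm (fiber f (y + e)) * norm (fiber f y))"
  proof (rule infsum_mono)
    show "(\<lambda>y. shift c (fiber f (y + e)) \<bullet> fiber f y) summable_on UNIV"
      using infsum_prod_UNIV(2)[OF shift_form_summable[of f "(e, c)"]] unfolding s .
    show "(\<lambda>y. norm (fiber f (y + e)) * norm (fiber f y)) summable_on UNIV"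
      using shift_form_summable[of "fiber_norm f" e] unfolding r .
    show "shift c (fiber f (y + e)) \<bullet> fiber f y \<le> norm (fiber f (y + e)) * norm (fiber f y)" for y
      using norm_cauchy_schwarz[of "shift c (fiber f (y + e))" "fiber f y"] by simp
  qed
  also have "\<dots> = shift_form e (fiber_norm f)" unfolding shift_form_eq r ..
  finally show ?thesis .
qed

lemma mass_fst:
  "mass {x. fst x = y} f = (norm (fiber f y))\<^sup>2"
proof -
  have "(\<Sum>\<^sub>\<infinity>z. indicator {x. fst x = y} (w, z) * (cmod (l2_fun f (w, z)))\<^sup>2)
      = (if w = y then (norm (fiber f y))\<^sup>2 else 0)" for w
    by (auto simp: fiber_norm_sq)
  then have "mass {x. fst x = y} f = (\<Sum>\<^sub>\<infinity>w. if w = y then (norm (fiber f y))\<^sup>2 else 0)"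
    unfolding mass_def infsum_prod_UNIV(1)[OF mass_summable, symmetric] by simp
  also have "\<dots> = (\<Sum>\<^sub>\<infinity>w\<in>{y}. (norm (fiber f y))\<^sup>2)"
    by (rule infsum_cong_neutral) auto
  finally show ?thesis by simp
qed

section \<open>Exchange of the coordinates and tensor squares\<close>

definition swap_l2 :: "('b \<times> 'c) l2 \<Rightarrow> ('c \<times> 'b) l2" where
  "swap_l2 f = to_l2 (\<lambda>x. l2_fun f (prod.swap x))"

lemma infsum_swap_UNIV: "(\<Sum>\<^sub>\<infinity>x. a (prod.swap x)) = (\<Sum>\<^sub>\<infinity>x. a x)"
  by (rule infsum_reindex_bij_witness[where i = prod.swap and j = prod.swap]) auto

lemma l2_fun_swap [simp]: "l2_fun (swap_l2 f) x = l2_fun f (prod.swap x)"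
proof -
  have "(\<lambda>x. (cmod (l2_fun f (prod.swap x)))\<^sup>2) summable_on UNIV \<longleftrightarrow> (\<lambda>x. (cmod (l2_fun f x))\<^sup>2) summable_on UNIV"
    by (rule summable_on_reindex_bij_witness[where i = prod.swap and j = prod.swap]) auto
  then have "(\<lambda>x. l2_fun f (prod.swap x)) \<in> ell2"
    using l2_summable_sq[of f] by (simp add: ell2_def)
  then show ?thesis by (simp add: swap_l2_def to_l2_inverse)
qed

lemma norm_swap_l2: "(norm (swap_l2 f))\<^sup>2 = (norm f)\<^sup>2"
  using infsum_swap_UNIV[of "\<lambda>x. (cmod (l2_fun f x))\<^sup>2"] by (simp add: l2_norm_sq)

lemma shift_form_swap: "shift_form s (swap_l2 f) = shift_form (prod.swap s) f"
proof -
  have "prod.swap (x + s) = prod.swap x + prod.swap s" for x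
    by (simp add: prod_eq_iff)
  then show ?thesis
    using infsum_swap_UNIV[of "\<lambda>x. l2_fun f (x + prod.swap s) \<bullet> l2_fun f x"] by (simp add: shift_form_eq)
qed

lemma mass_swap: "mass A (swap_l2 f) = mass (prod.swap ` A) f"
proof -
  have "indicat_real A x = indicator (prod.swap ` A) (prod.swap x)" for x
    by (cases x) (auto simp: indicator_def image_iff)
  then show ?thesis
    using infsum_swap_UNIV[of "\<lambda>x. indicator (prod.swap ` A) x * (cmod (l2_fun f x))\<^sup>2"]
    by (simp add: mass_def)
qed

definition square_tensor :: "'b l2 \<Rightarrow> ('b \<times> 'b) l2" where
  "square_tensor f = to_l2 (\<lambda>x. l2_fun f (fst x) * l2_fun f (snd x))"

lemma l2_fun_square_tensor [simp]: "l2_fun (square_tensor f) (y, z) = l2_fun f y * l2_fun f z"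
proof -
  let ?a = "\<lambda>y. (cmod (l2_fun f y))\<^sup>2"
  have "(\<lambda>x. ?a (fst x) * ?a (snd x)) summable_on (Sigma UNIV (\<lambda>_. UNIV))"
  proof (rule summable_on_SigmaI)
    show "((\<lambda>z. ?a (fst (y, z)) * ?a (snd (y, z))) has_sum (?a y * infsum ?a UNIV)) UNIV" for y
      unfolding fst_conv snd_conv by (intro has_sum_cmult_right has_sum_infsum l2_summable_sq)
    show "(\<lambda>y. ?a y * infsum ?a UNIV) summable_on UNIV"
      by (intro summable_on_cmult_left l2_summable_sq)
  qed auto
  then have "(\<lambda>x. l2_fun f (fst x) * l2_fun f (snd x)) \<in> ell2"
    by (simp add: ell2_def norm_mult power_mult_distrib)
  then show ?thesis by (simp add: square_tensor_def to_l2_inverse)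
qed

lemma norm_square_tensor: "(norm (square_tensor f))\<^sup>2 = (norm f)\<^sup>2 * (norm f)\<^sup>2"
  using infsum_prod_UNIV(1)[OF l2_summable_sq[of "square_tensor f"]]
  by (simp add: l2_norm_sq norm_mult power_mult_distrib infsum_cmult_right' infsum_cmult_left')

text \<open>For real values the real inner product of complex numbers is an ordinary product, so the
  double sum factors.\<close>

lemma shift_form_square_tensor:
  assumes "\<And>y. l2_fun f y \<in> \<real>"
  shows "shift_form (e, c) (square_tensor f) = shift_form e f * shift_form c f"
proof -
  have *: "(a * b) \<bullet> (a' * b') = (a \<bullet> a') * (b \<bullet> b')"
    if "a \<in> \<real>" "b \<in> \<real>" "a' \<in> \<real>" "b' \<in> \<real>" for a b a' b' :: complex
    using that by (auto elim!: Reals_cases simp: inner_complex_def)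
  show ?thesis
    using infsum_prod_UNIV(1)[OF shift_form_summable[of "square_tensor f" "(e, c)"]]
    by (simp add: shift_form_eq * assms infsum_cmult_right' infsum_cmult_left')
qed

lemma mass_square_tensor:
  "mass {x. fst x = y} (square_tensor f) = (cmod (l2_fun f y))\<^sup>2 * (norm f)\<^sup>2"
  "mass {x. snd x = y} (square_tensor f) = (cmod (l2_fun f y))\<^sup>2 * (norm f)\<^sup>2"
proof -
  show *: "mass {x. fst x = y} (square_tensor f) = (cmod (l2_fun f y))\<^sup>2 * (norm f)\<^sup>2"
    unfolding mass_fst fiber_norm_sq
    by (simp add: norm_mult power_mult_distrib infsum_cmult_right' l2_norm_sq)
  have "swap_l2 (square_tensor f) = square_tensor f"
    by (intro l2_eqI) (auto simp: mult.commute split: prod.splits)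
  moreover have "prod.swap ` {x. fst x = y} = {x. snd x = y}"
    by (auto simp: image_iff)
  ultimately show "mass {x. snd x = y} (square_tensor f) = (cmod (l2_fun f y))\<^sup>2 * (norm f)\<^sup>2"
    using mass_swap[of "{x. fst x = y}" "square_tensor f"] * by metis
qed

section \<open>Localization and absolute values\<close>

text \<open>Since the squares of cosine and sine add up to 1, the cut-offs form a quadratic
  partition of unity, and squared norms and masses split without error.\<close>

lemma ims_norm:
  fixes \<theta> :: "'a \<Rightarrow> real"
  shows "(norm (lmult (\<lambda>x. of_real (cos (\<theta> x))) f))\<^sup>2 + (norm (lmult (\<lambda>x. of_real (sin (\<theta> x))) f))\<^sup>2 = (norm f)\<^sup>2"
    (is "(norm ?c)\<^sup>2 + (norm ?s)\<^sup>2 = _")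
    and ims_mass: "mass A (lmult (\<lambda>x. of_real (cos (\<theta> x))) f) + mass A (lmult (\<lambda>x. of_real (sin (\<theta> x))) f) = mass A f"
proof -
  have c: "l2_fun ?c x = of_real (cos (\<theta> x)) * l2_fun f x" for x
    by (rule l2_fun_lmult[where K = 1]) simp
  have s: "l2_fun ?s x = of_real (sin (\<theta> x)) * l2_fun f x" for x
    by (rule l2_fun_lmult[where K = 1]) simp
  have *: "(cmod (l2_fun ?c x))\<^sup>2 + (cmod (l2_fun ?s x))\<^sup>2 = (cmod (l2_fun f x))\<^sup>2" for x
    by (simp add: c s norm_mult power_mult_distrib flip: distrib_right)
  show "(norm ?c)\<^sup>2 + (norm ?s)\<^sup>2 = (norm f)\<^sup>2"
    unfolding l2_norm_sq *[symmetric] by (rule infsum_add[symmetric]) (rule l2_summable_sq)+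
  show "mass A ?c + mass A ?s = mass A f"
    unfolding mass_def *[symmetric] distrib_left
    by (rule infsum_add[symmetric]) (rule mass_summable)+
qed

text \<open>The localization error: \<open>cos \<theta> cos \<theta>' + sin \<theta> sin \<theta>' = cos (\<theta> - \<theta>') \<ge> 1 - (\<theta> - \<theta>')\<^sup>2 / 2\<close>.\<close>
lemma ims_shift_form:
  fixes \<theta> :: "'a::ab_group_add \<Rightarrow> real"
  assumes "\<And>x. \<bar>\<theta> (x + s) - \<theta> x\<bar> \<le> \<eta>"
  shows "shift_form s f \<le> shift_form s (lmult (\<lambda>x. of_real (cos (\<theta> x))) f)
    + shift_form s (lmult (\<lambda>x. of_real (sin (\<theta> x))) f) + \<eta>\<^sup>2 / 2 * (norm f)\<^sup>2"
    (is "_ \<le> shift_form s ?c + shift_form s ?s + _")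
proof -
  have c: "l2_fun ?c x = of_real (cos (\<theta> x)) * l2_fun f x" for x
    by (rule l2_fun_lmult[where K = 1]) simp
  have s: "l2_fun ?s x = of_real (sin (\<theta> x)) * l2_fun f x" for x
    by (rule l2_fun_lmult[where K = 1]) simp
  let ?b = "\<lambda>x. (cmod (l2_fun (shift s f) x))\<^sup>2 + (cmod (l2_fun f x))\<^sup>2"
  have b: "?b summable_on UNIV" by (intro summable_on_add l2_summable_sq)
  have pw: "l2_fun f (x + s) \<bullet> l2_fun f x \<le> l2_fun ?c (x + s) \<bullet> l2_fun ?c x + l2_fun ?s (x + s) \<bullet> l2_fun ?s x
      + \<eta>\<^sup>2 / 4 * ?b x" for x
  proof -
    define t where "t = \<theta> (x + s) - \<theta> x"
    define u v where "u = l2_fun f (x + s)" and "v = l2_fun f x"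
    have "1 - cos t = 2 * (sin (t / 2))\<^sup>2"
      using cos_double_sin[of "t / 2"] by simp
    also have "(sin (t / 2))\<^sup>2 \<le> (t / 2)\<^sup>2"
      unfolding abs_le_square_iff[symmetric] by (rule abs_sin_x_le_abs_x)
    also have "2 * (t / 2)\<^sup>2 = t\<^sup>2 / 2" by (simp add: power2_eq_square)
    also have "t\<^sup>2 \<le> \<eta>\<^sup>2"
      using power_mono[OF assms[of x] abs_ge_zero, of 2] by (simp add: t_def)
    finally have ct: "1 - cos t \<le> \<eta>\<^sup>2 / 2" by simp
    have "u \<bullet> v \<le> cmod u * cmod v" by (rule norm_cauchy_schwarz)
    also have "\<dots> \<le> ((cmod u)\<^sup>2 + (cmod v)\<^sup>2) / 2"
      using sum_squares_bound[of "cmod u" "cmod v"] by simp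
    finally have uv: "u \<bullet> v \<le> ((cmod u)\<^sup>2 + (cmod v)\<^sup>2) / 2" .
    \<comment> \<open>As \<open>u \<bullet> v\<close> may be negative, it is first replaced by its
      nonnegative upper bound; only then is the bound on \<open>1 - cos t\<close> inserted.\<close>
    have "(1 - cos t) * (u \<bullet> v) \<le> (1 - cos t) * (((cmod u)\<^sup>2 + (cmod v)\<^sup>2) / 2)"
      by (rule mult_left_mono[OF uv]) simp
    also have "\<dots> \<le> \<eta>\<^sup>2 / 2 * (((cmod u)\<^sup>2 + (cmod v)\<^sup>2) / 2)"
      by (rule mult_right_mono[OF ct]) simp
    finally have "u \<bullet> v \<le> cos t * (u \<bullet> v) + \<eta>\<^sup>2 / 4 * ((cmod u)\<^sup>2 + (cmod v)\<^sup>2)"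
      by (simp add: algebra_simps)
    moreover have "l2_fun ?c (x + s) \<bullet> l2_fun ?c x + l2_fun ?s (x + s) \<bullet> l2_fun ?s x = cos t * (u \<bullet> v)"
      unfolding c s t_def cos_diff u_def v_def
      by (simp add: inner_complex_def algebra_simps)
    ultimately show ?thesis by (simp add: u_def v_def)
  qed
  have "shift_form s f \<le> (\<Sum>\<^sub>\<infinity>x. l2_fun ?c (x + s) \<bullet> l2_fun ?c x + l2_fun ?s (x + s) \<bullet> l2_fun ?s x + \<eta>\<^sup>2 / 4 * ?b x)"
    unfolding shift_form_eq
    by (intro infsum_mono pw shift_form_summable summable_on_add summable_on_cmult_right l2_summable_sq)
  also have "\<dots> = shift_form s ?c + shift_form s ?s + \<eta>\<^sup>2 / 4 * (\<Sum>\<^sub>\<infinity>x. ?b x)"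
    unfolding shift_form_eq
    by (simp only: infsum_add infsum_cmult_right shift_form_summable summable_on_add summable_on_cmult_right b)
  \<comment> \<open>The shift is isometric, so this is twice the squared norm of \<open>f\<close>
    and the factor \<open>\<eta>\<^sup>2 / 4\<close> becomes
    \<open>\<eta>\<^sup>2 / 2\<close>.\<close>
  also have "(\<Sum>\<^sub>\<infinity>x. ?b x) = (norm (shift s f))\<^sup>2 + (norm f)\<^sup>2"
    unfolding l2_norm_sq by (rule infsum_add) (rule l2_summable_sq)+
  finally show ?thesis by simp
qed

section \<open>Passage to absolute values\<close>

definition l2_abs :: "'a l2 \<Rightarrow> 'a l2" where
  "l2_abs f = to_l2 (\<lambda>x. of_real (cmod (l2_fun f x)))"

lemma l2_fun_abs [simp]: "l2_fun (l2_abs f) x = of_real (cmod (l2_fun f x))"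
  using ell2_bounded_mult[OF l2_fun_ell2[of f], of "\<lambda>x. of_real (cmod (l2_fun f x))" 1]
  by (simp add: l2_abs_def to_l2_inverse)

lemma norm_l2_abs [simp]: "norm (l2_abs f) = norm f"
proof -
  have "(norm (l2_abs f))\<^sup>2 = (norm f)\<^sup>2" by (simp add: l2_norm_sq)
  then show ?thesis by simp
qed

lemma mass_l2_abs [simp]: "mass A (l2_abs f) = mass A f"
  by (simp add: mass_def)

lemma shift_form_l2_abs: "shift_form s f \<le> shift_form s (l2_abs f)"
  unfolding shift_form_eq
proof (rule infsum_mono)
  show "l2_fun f (x + s) \<bullet> l2_fun f x \<le> l2_fun (l2_abs f) (x + s) \<bullet> l2_fun (l2_abs f) x" for x
    using norm_cauchy_schwarz[of "l2_fun f (x + s)" "l2_fun f x"] by (simp add: inner_complex_def)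
qed (rule shift_form_summable)+

section \<open>The lattice\<close>

lemma real_of_lattice_simps [simp]:
  "real_of_lattice 0 = 0" "real_of_lattice (- v) = - real_of_lattice v"
  "real_of_lattice (v + w) = real_of_lattice v + real_of_lattice w"
  "real_of_lattice (axis i k) = axis i (of_int k)"
  by (simp_all add: real_of_lattice_def vec_eq_iff axis_def)

lemma real_of_lattice_eq_0_iff [simp]: "real_of_lattice v = 0 \<longleftrightarrow> v = 0"
  by (simp add: real_of_lattice_def vec_eq_iff)

lemma lattice_norm_sq: "\<exists>k\<ge>0. (norm (real_of_lattice v))\<^sup>2 = real_of_int k"
proof (intro exI conjI)
  show "(norm (real_of_lattice v))\<^sup>2 = real_of_int (\<Sum>i\<in>UNIV. (v $ i)\<^sup>2)"
    unfolding power2_norm_eq_inner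
    by (simp add: inner_vec_def real_of_lattice_def power2_eq_square)
qed (simp add: sum_nonneg)

text \<open>The squared norms of the two components are nonnegative integers with sum 1, so one of
  them is 0 and the other is 1.\<close>

lemma lattice_pair_units_eq:
  "lattice_pair_units = (\<lambda>e. (e, 0)) ` lattice_units \<union> (\<lambda>e. (0, e)) ` lattice_units"
proof (intro equalityI subsetI)
  fix x :: "(int ^ 'd) \<times> (int ^ 'd)"
  assume "x \<in> lattice_pair_units"
  moreover obtain a b where x: "x = (a, b)" by (cases x)
  ultimately have *: "(norm (real_of_lattice a))\<^sup>2 + (norm (real_of_lattice b))\<^sup>2 = 1"
    by (simp add: lattice_pair_units_def norm_Pair)
  obtain k where k: "k \<ge> 0" "(norm (real_of_lattice a))\<^sup>2 = real_of_int k"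
    using lattice_norm_sq by blast
  obtain l where l: "l \<ge> 0" "(norm (real_of_lattice b))\<^sup>2 = real_of_int l"
    using lattice_norm_sq by blast
  have "k + l = 1" using * k l by linarith
  then consider "k = 1" "l = 0" | "k = 0" "l = 1" using k l by linarith
  then show "x \<in> (\<lambda>e. (e, 0)) ` lattice_units \<union> (\<lambda>e. (0, e)) ` lattice_units"
  proof cases
    case 1
    then have "b = 0" "norm (real_of_lattice a) = 1"
      using k l by (auto simp: power2_eq_1_iff) (smt (verit) norm_ge_zero)
    then show ?thesis by (simp add: x lattice_units_def)
  next
    case 2
    then have "a = 0" "norm (real_of_lattice b) = 1"
      using k l by (auto simp: power2_eq_1_iff) (smt (verit) norm_ge_zero)
    then show ?thesis by (simp add: x lattice_units_def)
  qed
qed (auto simp: lattice_units_def lattice_pair_units_def norm_Pair)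

lemma zero_notin_lattice_units: "0 \<notin> lattice_units"
  by (simp add: lattice_units_def)

lemma sum_lattice_pair_units:
  "(\<Sum>e\<in>lattice_pair_units. a e) = (\<Sum>e\<in>lattice_units. a (e, 0)) + (\<Sum>e\<in>lattice_units. a (0, e))"
proof -
  have "(\<Sum>e\<in>lattice_pair_units. a e)
      = (\<Sum>e\<in>(\<lambda>e. (e, 0)) ` lattice_units. a e) + (\<Sum>e\<in>(\<lambda>e. (0, e)) ` lattice_units. a e)"
    unfolding lattice_pair_units_eq using zero_notin_lattice_units
    by (intro sum.union_disjoint) (auto simp: finite_lattice_units)
  then show ?thesis by (simp add: sum.reindex inj_on_def)
qed

lemma sum_lattice_units_uminus: "(\<Sum>e\<in>lattice_units. a (- e)) = (\<Sum>e\<in>lattice_units. a e)"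
  by (rule sum.reindex_bij_witness[where i = uminus and j = uminus]) (auto simp: lattice_units_def)

section \<open>Finiteness of balls and connectedness of the lattice\<close>

lemma finite_lattice_norm_le: "finite {v :: int ^ 'd. norm (real_of_lattice v) \<le> r}"
proof (rule finite_subset)
  show "{v :: int ^ 'd. norm (real_of_lattice v) \<le> r} \<subseteq> vec_lambda ` (UNIV \<rightarrow>\<^sub>E {\<lfloor>-r\<rfloor>..\<lceil>r\<rceil>})"
  proof
    fix v :: "int ^ 'd"
    assume "v \<in> {v. norm (real_of_lattice v) \<le> r}"
    then have "\<bar>real_of_int (v $ i)\<bar> \<le> r" for i
      using component_le_norm_cart[of "real_of_lattice v" i] by (simp add: real_of_lattice_def)
    then have "v $ i \<in> {\<lfloor>-r\<rfloor>..\<lceil>r\<rceil>}" for i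
      by (auto simp: abs_le_iff le_ceiling_iff floor_le_iff) (smt (verit))+
    then show "v \<in> vec_lambda ` (UNIV \<rightarrow>\<^sub>E {\<lfloor>-r\<rfloor>..\<lceil>r\<rceil>})"
      by (intro image_eqI[of _ _ "vec_nth v"]) auto
  qed
qed (simp add: finite_PiE)

text \<open>Integer induction in both directions moves \<open>P\<close> along a coordinate line;
  then the coordinates of \<open>x\<close> are corrected to those of \<open>y\<close> one at a
  time.\<close>

lemma lattice_connected:
  fixes x y :: "int ^ 'd"
  assumes "P x" and step: "\<And>x e. P x \<Longrightarrow> e \<in> lattice_units \<Longrightarrow> P (x + e)"
  shows "P y"
proof -
  have unit: "axis i 1 \<in> (lattice_units :: (int ^ 'd) set)" "axis i (- 1) \<in> (lattice_units :: (int ^ 'd) set)" for i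
    by (simp_all add: lattice_units_def norm_eq_sqrt_inner inner_axis_axis)
  have line: "P (z + axis i k)" if "P z" for z i k
  proof (induction k rule: int_induct[of _ 0])
    case base
    have "z + axis i 0 = z" by (simp add: axis_def vec_eq_iff)
    then show ?case using that by metis
  next
    case (step1 k)
    have "z + axis i (k + 1) = z + axis i k + axis i 1"
      by (simp add: axis_def vec_eq_iff)
    then show ?case using step[OF step1(2) unit(1)[of i]] by metis
  next
    case (step2 k)
    have "z + axis i (k - 1) = z + axis i k + axis i (- 1)"
      by (simp add: axis_def vec_eq_iff)
    then show ?case using step[OF step2(2) unit(2)[of i]] by metis
  qed
  have "P (x + (\<Sum>i\<in>A. axis i ((y - x) $ i)))" if "finite A" for A
    using that
  proof (induction A)
    case empty
    then show ?case using assms(1) by simp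
  next
    case (insert i A)
    then show ?case using line[OF insert.IH, of i "(y - x) $ i"] by (simp add: add_ac)
  qed
  moreover have "x + (\<Sum>i\<in>UNIV. axis i ((y - x) $ i)) = y"
    by (simp add: vec_eq_iff axis_def if_distrib[of "\<lambda>f. f $ _"] cong: if_cong)
  ultimately show ?thesis by (metis finite)
qed

section \<open>The Hamiltonian\<close>

text \<open>The operator \<open>op_H2\<close> on the Hilbert space type, assembled from shifts and
  multiplications so that boundedness and symmetry follow from these parts.\<close>

definition hamiltonian :: "real \<Rightarrow> real \<Rightarrow> real \<Rightarrow> ((int ^ 'd::finite) \<times> (int ^ 'd)) l2 \<Rightarrow> ((int ^ 'd) \<times> (int ^ 'd)) l2" where
  "hamiltonian \<kappa> \<rho> \<gamma> f =
     \<kappa> *\<^sub>R (\<Sum>e\<in>lattice_pair_units. shift e f - f) + \<rho> *\<^sub>R (\<Sum>e\<in>lattice_units. shift (e, e) f - f)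
     + \<gamma> *\<^sub>R (lmult (indicator {x. fst x = 0}) f + lmult (indicator {x. snd x = 0}) f)"

lemma cmod_indicator_le: "cmod (indicator A x) \<le> 1"
  by (auto simp: indicator_def)

lemma l2_fun_hamiltonian:
  fixes f :: "((int ^ 'd::finite) \<times> (int ^ 'd)) l2"
  shows "l2_fun (hamiltonian \<kappa> \<rho> \<gamma> f) = op_H2 \<kappa> \<rho> \<gamma> (l2_fun f)"
proof
  fix x :: "(int ^ 'd) \<times> (int ^ 'd)"
  have "indicator {x :: (int ^ 'd) \<times> (int ^ 'd). fst x = 0} x = (indicator {0} (fst x) :: complex)"
    "indicator {x :: (int ^ 'd) \<times> (int ^ 'd). snd x = 0} x = (indicator {0} (snd x) :: complex)"
    by (auto simp: indicator_def)
  moreover have "x + (e, e) = (fst x + e, snd x + e)" for e by (simp add: prod_eq_iff)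
  ultimately show "l2_fun (hamiltonian \<kappa> \<rho> \<gamma> f) x = op_H2 \<kappa> \<rho> \<gamma> (l2_fun f) x"
    by (simp add: hamiltonian_def op_H2_def op_A2_def op_V2_def l2_fun_lmult[OF cmod_indicator_le]
        scaleR_conv_of_real algebra_simps)
qed

lemma bounded_linear_hamiltonian: "bounded_linear (hamiltonian \<kappa> \<rho> \<gamma>)"
  unfolding hamiltonian_def
  by (intro bounded_linear_add bounded_linear_sum bounded_linear_sub bounded_linear_shift
      bounded_linear_lmult[OF cmod_indicator_le] bounded_linear_ident
      bounded_linear_compose[OF bounded_linear_scaleR_right])

text \<open>The adjoint of a shift is the opposite shift, and the sets of jumps are invariant under
  negation.\<close>

lemma hamiltonian_symmetric: "hamiltonian \<kappa> \<rho> \<gamma> f \<bullet> g = f \<bullet> hamiltonian \<kappa> \<rho> \<gamma> g"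
proof -
  have 1: "(\<Sum>e\<in>lattice_pair_units. shift e f - f) \<bullet> g = f \<bullet> (\<Sum>e\<in>lattice_pair_units. shift e g - g)"
    using sum_lattice_units_uminus[of "\<lambda>e. f \<bullet> shift (e, 0) g"]
      sum_lattice_units_uminus[of "\<lambda>e. f \<bullet> shift (0, e) g"]
    unfolding sum_lattice_pair_units
    by (simp add: inner_sum_left inner_sum_right inner_diff_left inner_diff_right
        inner_add_left inner_add_right shift_inner sum_subtractf)
  have 2: "(\<Sum>e\<in>lattice_units. shift (e, e) f - f) \<bullet> g = f \<bullet> (\<Sum>e\<in>lattice_units. shift (e, e) g - g)"
    using sum_lattice_units_uminus[of "\<lambda>e. f \<bullet> shift (e, e) g"]
    by (simp add: inner_sum_left inner_sum_right inner_diff_left inner_diff_right shift_inner sum_subtractf)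
  have 3: "lmult (indicator A) f \<bullet> g = f \<bullet> lmult (indicator A) g" for A
    by (rule lmult_inner[OF cmod_indicator_le]) (auto simp: indicator_def)
  show ?thesis
    unfolding hamiltonian_def inner_add_left inner_add_right inner_scaleR_left inner_scaleR_right 1 2 3 ..
qed

text \<open>The form of \<open>\<A>\<^sup>2\<close>, arranged as a single sum over unit vectors of
  one particle so that the jumps of the first particle, of the second and of both can be compared
  term by term.\<close>

definition kinetic :: "real \<Rightarrow> real \<Rightarrow> ((int ^ 'd::finite) \<times> (int ^ 'd)) l2 \<Rightarrow> real" where
  "kinetic \<kappa> \<rho> f = (\<Sum>e\<in>lattice_units. \<kappa> * (shift_form (e, 0) f - (norm f)\<^sup>2)
     + \<kappa> * (shift_form (0, e) f - (norm f)\<^sup>2) + \<rho> * (shift_form (e, e) f - (norm f)\<^sup>2))"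

lemma hamiltonian_form:
  "hamiltonian \<kappa> \<rho> \<gamma> f \<bullet> f
    = kinetic \<kappa> \<rho> f + \<gamma> * (mass {x. fst x = 0} f + mass {x. snd x = 0} f)"
  by (simp add: hamiltonian_def kinetic_def inner_add_left inner_diff_left inner_sum_left mass_inner
      sum_lattice_pair_units sum.distrib sum_subtractf power2_norm_eq_inner shift_form_def
      sum_distrib_left[symmetric] algebra_simps)

section \<open>Inequalities for the form of the Hamiltonian\<close>

lemma kinetic_swap: "kinetic \<kappa> \<rho> (swap_l2 f) = kinetic \<kappa> \<rho> f"
  by (simp add: kinetic_def shift_form_swap norm_swap_l2 add_ac)

text \<open>The potential depends on absolute values only, while each hopping energy can only grow
  and carries a nonnegative weight.\<close>

lemma hamiltonian_l2_abs:
  assumes "\<kappa> \<ge> 0" "\<rho> \<ge> 0"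
  shows "hamiltonian \<kappa> \<rho> \<gamma> f \<bullet> f \<le> hamiltonian \<kappa> \<rho> \<gamma> (l2_abs f) \<bullet> l2_abs f"
  unfolding hamiltonian_form kinetic_def mass_l2_abs norm_l2_abs
  by (intro add_right_mono sum_mono add_mono mult_left_mono diff_right_mono shift_form_l2_abs assms)

text \<open>Evaluate the form at \<open>f \<otimes> f\<close> and use \<open>a\<^sup>2 - N\<^sup>2 \<ge> 2 N (a - N)\<close>.\<close>
lemma one_particle_bound:
  fixes f :: "(int ^ 'd::finite) l2"
  assumes "\<rho> \<ge> 0" and real: "\<And>y. l2_fun f y \<in> \<real>"
    and upper: "\<And>g :: ((int ^ 'd) \<times> (int ^ 'd)) l2. hamiltonian \<kappa> \<rho> \<gamma> g \<bullet> g \<le> M * (norm g)\<^sup>2"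
  shows "(\<Sum>e\<in>lattice_units. (\<kappa> + \<rho>) * (shift_form e f - (norm f)\<^sup>2)) + \<gamma> * (cmod (l2_fun f 0))\<^sup>2
    \<le> M / 2 * (norm f)\<^sup>2"
proof (cases "f = 0")
  case True
  then have "shift_form e f = 0" for e by (simp add: shift_form_def)
  then show ?thesis using True by simp
next
  case False
  define N where "N = (norm f)\<^sup>2"
  have N: "N > 0" using False by (simp add: N_def)
  define a where "a e = shift_form e f" for e
  \<comment> \<open>The shift by \<open>(e, 0)\<close> contributes \<open>a e * a 0\<close> at the
    tensor square, so the resting particle supplies a factor \<open>N\<close>.\<close>
  have a0: "a 0 = N" by (simp add: a_def N_def shift_form_eq l2_norm_sq power2_norm_eq_inner)
  let ?P = "(cmod (l2_fun f 0))\<^sup>2"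
  have "(2 * N) * ((\<Sum>e\<in>lattice_units. (\<kappa> + \<rho>) * (a e - N)) + \<gamma> * ?P)
      = (\<Sum>e\<in>lattice_units. 2 * \<kappa> * N * (a e - N) + \<rho> * (2 * N * (a e - N))) + 2 * \<gamma> * ?P * N"
    by (simp add: sum_distrib_left algebra_simps)
  also have "\<dots> \<le> (\<Sum>e\<in>lattice_units. 2 * \<kappa> * N * (a e - N) + \<rho> * (a e * a e - N * N)) + 2 * \<gamma> * ?P * N"
  proof (intro add_right_mono sum_mono add_left_mono mult_left_mono assms(1))
    show "2 * N * (a e - N) \<le> a e * a e - N * N" for e
      using zero_le_square[of "a e - N"] by (simp add: algebra_simps)
  qed
  also have "\<dots> = hamiltonian \<kappa> \<rho> \<gamma> (square_tensor f) \<bullet> square_tensor f"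
    by (simp add: hamiltonian_form kinetic_def shift_form_square_tensor[OF real] a0 norm_square_tensor
        mass_square_tensor algebra_simps flip: N_def a_def)
  also have "\<dots> \<le> (2 * N) * (M / 2 * N)"
    using upper[of "square_tensor f"] by (simp add: norm_square_tensor N_def mult_ac)
  finally show ?thesis using N by (simp add: N_def a_def)
qed

text \<open>Pass to \<open>fiber_norm f\<close>. Jumps of the first particle and joint jumps both
  become jumps of the fiber norm, with total weight \<open>\<kappa> + \<rho>\<close>, and jumps of
  the second particle alone contribute at most 0. What remains is the form in
  \<open>one_particle_bound\<close>. Exchanging the coordinates gives the other half.\<close>

lemma half_space_bound:
  fixes f :: "((int ^ 'd::finite) \<times> (int ^ 'd)) l2"
  assumes "\<kappa> \<ge> 0" "\<rho> \<ge> 0"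
    and upper: "\<And>g :: ((int ^ 'd) \<times> (int ^ 'd)) l2. hamiltonian \<kappa> \<rho> \<gamma> g \<bullet> g \<le> M * (norm g)\<^sup>2"
  shows "kinetic \<kappa> \<rho> f + \<gamma> * mass {x. fst x = 0} f \<le> M / 2 * (norm f)\<^sup>2"
    and "kinetic \<kappa> \<rho> f + \<gamma> * mass {x. snd x = 0} f \<le> M / 2 * (norm f)\<^sup>2"
proof -
  show *: "kinetic \<kappa> \<rho> f + \<gamma> * mass {x. fst x = 0} f \<le> M / 2 * (norm f)\<^sup>2"
    for f :: "((int ^ 'd) \<times> (int ^ 'd)) l2"
  proof -
    let ?g = "fiber_norm f"
    have "kinetic \<kappa> \<rho> f \<le> (\<Sum>e\<in>lattice_units. \<kappa> * (shift_form e ?g - (norm f)\<^sup>2) + \<kappa> * 0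
        + \<rho> * (shift_form e ?g - (norm f)\<^sup>2))"
      unfolding kinetic_def
    proof (intro sum_mono add_mono mult_left_mono assms)
      show "shift_form (0, e) f - (norm f)\<^sup>2 \<le> 0" for e
        using shift_form_le[of "(0, e)" f] by simp
    qed (use shift_form_le_fiber_norm[of _ _ f] in auto)
    moreover have "mass {x. fst x = 0} f = (cmod (l2_fun ?g 0))\<^sup>2"
      by (simp add: mass_fst)
    ultimately show ?thesis
      using one_particle_bound[OF assms(2) _ upper, of ?g]
      by (simp add: norm_fiber_norm algebra_simps)
  qed
  have "prod.swap ` {x :: (int ^ 'd) \<times> (int ^ 'd). fst x = 0} = {x. snd x = 0}"
    by (auto simp: image_iff)
  then show "kinetic \<kappa> \<rho> f + \<gamma> * mass {x. snd x = 0} f \<le> M / 2 * (norm f)\<^sup>2"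
    using *[of "swap_l2 f"] by (simp add: kinetic_swap mass_swap norm_swap_l2)
qed

lemma scaled_clamp_diff_le:
  fixes a b c :: real
  assumes "c \<ge> 0"
  shows "\<bar>c * max 0 (min 1 a) - c * max 0 (min 1 b)\<bar> \<le> c * \<bar>a - b\<bar>"
proof -
  have "\<bar>c * u - c * v\<bar> = c * \<bar>u - v\<bar>" for u v
    using assms by (metis abs_mult abs_of_nonneg right_diff_distrib)
  moreover have "\<bar>max 0 (min 1 a) - max 0 (min 1 b)\<bar> \<le> \<bar>a - b\<bar>"
    by (auto simp: max_def min_def)
  ultimately show ?thesis using assms by (simp add: mult_left_mono)
qed

text \<open>On the support of \<open>cos \<theta>\<close> we have \<open>|x\<^sub>1| < |x\<^sub>2| + R\<close>, so that \<open>x\<^sub>2 = 0\<close> only on a finite set; on the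
  support of \<open>sin \<theta>\<close> we have \<open>|x\<^sub>1| > |x\<^sub>2|\<close>, so that \<open>x\<^sub>1 \<noteq> 0\<close>.\<close>
lemma essential_bound:
  assumes "\<kappa> \<ge> 0" "\<rho> \<ge> 0" "\<gamma> \<ge> 0" "\<epsilon> > 0"
    and upper: "\<And>g :: ((int ^ 'd::finite) \<times> (int ^ 'd)) l2. hamiltonian \<kappa> \<rho> \<gamma> g \<bullet> g \<le> M * (norm g)\<^sup>2"
  shows "\<exists>F. finite F \<and> (\<forall>f :: ((int ^ 'd) \<times> (int ^ 'd)) l2. hamiltonian \<kappa> \<rho> \<gamma> f \<bullet> f
    \<le> (M / 2 + \<epsilon>) * (norm f)\<^sup>2 + \<gamma> * (\<Sum>x\<in>F. (cmod (l2_fun f x))\<^sup>2))"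
proof -
  let ?n = "\<lambda>v :: int ^ 'd. norm (real_of_lattice v)"
  define U where "U = (lattice_units :: (int ^ 'd) set)"
  \<comment> \<open>Total weight of all jumps; the localization error will be
    \<open>c * (\<eta>\<^sup>2 / 2)\<close> times the squared norm.\<close>
  define c where "c = real (card U) * (2 * \<kappa> + \<rho>)"
  have c: "c \<ge> 0" using assms by (simp add: c_def)
  \<comment> \<open>Chosen so that the variation \<open>\<eta> = pi / R\<close> of the angle per
    jump satisfies \<open>c * \<eta> \<le> \<epsilon>\<close>. The summand 1 keeps
    \<open>\<eta>\<close> at most 1, so \<open>\<eta>\<^sup>2 / 2\<close> is bounded by
    \<open>\<eta>\<close>.\<close>
  define R where "R = pi * (1 + c / \<epsilon>)"
  have R: "R > 0" using c assms(4) by (simp add: R_def add_pos_nonneg)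
  define \<eta> where "\<eta> = pi / R"
  have \<eta>: "\<eta> = 1 / (1 + c / \<epsilon>)" by (simp add: \<eta>_def R_def)
  have \<eta>1: "0 < \<eta>" "\<eta> \<le> 1" using c assms(4) unfolding \<eta> by (auto simp: field_simps)
  have "c * (\<eta>\<^sup>2 / 2) \<le> c * \<eta>"
    using \<eta>1 c by (intro mult_left_mono) (auto simp: power2_eq_square mult_left_le)
  also have "\<dots> \<le> \<epsilon>"
    using c assms(4) unfolding \<eta> by (simp add: field_simps)
  finally have err: "c * (\<eta>\<^sup>2 / 2) \<le> \<epsilon>" .
  define \<theta> where "\<theta> x = pi / 2 * max 0 (min 1 ((?n (fst x) - ?n (snd x)) / R))" for x
  \<comment> \<open>A joint jump changes the difference of the two norms by at most 2, and
    \<open>pi / 2 * (2 / R)\<close> is \<open>\<eta>\<close>.\<close>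
  have lip: "\<bar>\<theta> (x + s) - \<theta> x\<bar> \<le> \<eta>" if "?n (fst s) \<le> 1" "?n (snd s) \<le> 1" for x s
  proof -
    let ?a = "?n (fst (x + s)) - ?n (snd (x + s))" and ?b = "?n (fst x) - ?n (snd x)"
    have "\<bar>?a - ?b\<bar> \<le> 2"
      using that norm_triangle_ineq3[of "real_of_lattice (fst (x + s))" "real_of_lattice (fst x)"]
        norm_triangle_ineq3[of "real_of_lattice (snd (x + s))" "real_of_lattice (snd x)"]
      by simp
    then have "\<bar>?a / R - ?b / R\<bar> \<le> 2 / R"
      using R by (simp add: divide_right_mono flip: diff_divide_distrib)
    then have "pi / 2 * \<bar>?a / R - ?b / R\<bar> \<le> pi / 2 * (2 / R)"
      by (rule mult_left_mono) simp
    also have "\<dots> = \<eta>" by (simp add: \<eta>_def)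
    finally show ?thesis
      unfolding \<theta>_def by (rule order_trans[OF scaled_clamp_diff_le, rotated]) simp
  qed
  define F where "F = {x :: (int ^ 'd) \<times> (int ^ 'd). ?n (fst x) \<le> R \<and> snd x = 0}"
  have "F \<subseteq> {v. ?n v \<le> R} \<times> {0}" by (auto simp: F_def)
  then have F: "finite F"
    by (rule finite_subset) (simp add: finite_lattice_norm_le)
  have "hamiltonian \<kappa> \<rho> \<gamma> f \<bullet> f \<le> (M / 2 + \<epsilon>) * (norm f)\<^sup>2 + \<gamma> * (\<Sum>x\<in>F. (cmod (l2_fun f x))\<^sup>2)"
    for f :: "((int ^ 'd) \<times> (int ^ 'd)) l2"
  proof -
    define f1 where "f1 = lmult (\<lambda>x. of_real (cos (\<theta> x))) f"
    define f2 where "f2 = lmult (\<lambda>x. of_real (sin (\<theta> x))) f"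
    define N where "N = (norm f)\<^sup>2"
    have f1: "l2_fun f1 x = of_real (cos (\<theta> x)) * l2_fun f x" for x
      unfolding f1_def by (rule l2_fun_lmult[where K = 1]) simp
    have f2: "l2_fun f2 x = of_real (sin (\<theta> x)) * l2_fun f x" for x
      unfolding f2_def by (rule l2_fun_lmult[where K = 1]) simp
    have N: "N = (norm f1)\<^sup>2 + (norm f2)\<^sup>2"
      by (simp add: N_def f1_def f2_def ims_norm)
    have sf: "shift_form s f - N \<le> (shift_form s f1 - (norm f1)\<^sup>2) + (shift_form s f2 - (norm f2)\<^sup>2) + \<eta>\<^sup>2 / 2 * N"
      if "?n (fst s) \<le> 1" "?n (snd s) \<le> 1" for s
      using ims_shift_form[of \<theta> s \<eta> f, OF lip[OF that]] unfolding f1_def[symmetric] f2_def[symmetric] N_def[symmetric]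
      using N by linarith
    have un: "?n e = 1" if "e \<in> U" for e using that by (simp add: U_def lattice_units_def)
    have "kinetic \<kappa> \<rho> f \<le> (\<Sum>e\<in>U.
        \<kappa> * ((shift_form (e, 0) f1 - (norm f1)\<^sup>2) + (shift_form (e, 0) f2 - (norm f2)\<^sup>2) + \<eta>\<^sup>2 / 2 * N)
      + \<kappa> * ((shift_form (0, e) f1 - (norm f1)\<^sup>2) + (shift_form (0, e) f2 - (norm f2)\<^sup>2) + \<eta>\<^sup>2 / 2 * N)
      + \<rho> * ((shift_form (e, e) f1 - (norm f1)\<^sup>2) + (shift_form (e, e) f2 - (norm f2)\<^sup>2) + \<eta>\<^sup>2 / 2 * N))"
      unfolding kinetic_def N_def[symmetric] U_def[symmetric]
      by (intro sum_mono add_mono mult_left_mono sf assms) (auto simp: un)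
    also have "\<dots> = kinetic \<kappa> \<rho> f1 + kinetic \<kappa> \<rho> f2 + c * (\<eta>\<^sup>2 / 2) * N"
    proof -
      have *: "c * (\<eta>\<^sup>2 / 2) * N = (\<Sum>e\<in>U. (2 * \<kappa> + \<rho>) * (\<eta>\<^sup>2 / 2) * N)"
        by (simp add: c_def)
      show ?thesis
        unfolding * kinetic_def U_def[symmetric] sum.distrib[symmetric]
        by (intro sum.cong) (simp_all add: algebra_simps)
    qed
    also have "\<dots> \<le> kinetic \<kappa> \<rho> f1 + kinetic \<kappa> \<rho> f2 + \<epsilon> * N"
      using mult_right_mono[OF err, of N] by (simp add: N_def)
    finally have kin: "kinetic \<kappa> \<rho> f \<le> kinetic \<kappa> \<rho> f1 + kinetic \<kappa> \<rho> f2 + \<epsilon> * N" .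
    have m1: "mass {x. fst x = 0} f = mass {x. fst x = 0} f1"
    proof -
      have "mass {x. fst x = 0} f2 = 0"
      proof (rule mass_zero)
        fix x :: "(int ^ 'd) \<times> (int ^ 'd)"
        assume "x \<in> {x. fst x = 0}"
        then have "(?n (fst x) - ?n (snd x)) / R \<le> 0" using R by (simp add: divide_nonpos_pos)
        then have "\<theta> x = 0" by (simp add: \<theta>_def)
        then show "l2_fun f2 x = 0" by (simp add: f2)
      qed
      then show ?thesis using ims_mass[of "{x. fst x = 0}" \<theta> f] by (simp add: f1_def f2_def)
    qed
    have m2: "mass {x. snd x = 0} f \<le> mass {x. snd x = 0} f2 + (\<Sum>x\<in>F. (cmod (l2_fun f x))\<^sup>2)"
    proof -
      have "mass {x. snd x = 0} f1 \<le> (\<Sum>x\<in>F. (cmod (l2_fun f x))\<^sup>2)"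
      proof (rule mass_le_finite[OF F])
        fix x :: "(int ^ 'd) \<times> (int ^ 'd)"
        assume "x \<in> {x. snd x = 0}" "x \<notin> F"
        then have "(?n (fst x) - ?n (snd x)) / R \<ge> 1" using R by (simp add: F_def)
        then have "\<theta> x = pi / 2" by (simp add: \<theta>_def)
        then have "cos (\<theta> x) = 0" by (simp only: cos_pi_half)
        then show "l2_fun f1 x = 0" by (simp add: f1)
      next
        show "cmod (l2_fun f1 x) \<le> cmod (l2_fun f x)" for x
          by (simp add: f1 norm_mult mult_left_le_one_le)
      qed
      then show ?thesis using ims_mass[of "{x. snd x = 0}" \<theta> f] by (simp add: f1_def f2_def)
    qed
    \<comment> \<open>Up to the sum over \<open>F\<close>, the piece \<open>f1\<close> carries only
      the potential at \<open>x\<^sub>1 = 0\<close> and \<open>f2\<close> only that at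
      \<open>x\<^sub>2 = 0\<close>, so \<open>half_space_bound\<close> applies to each.\<close>
    have "hamiltonian \<kappa> \<rho> \<gamma> f \<bullet> f = kinetic \<kappa> \<rho> f + \<gamma> * mass {x. fst x = 0} f + \<gamma> * mass {x. snd x = 0} f"
      by (simp add: hamiltonian_form algebra_simps)
    also have "\<dots> \<le> (kinetic \<kappa> \<rho> f1 + \<gamma> * mass {x. fst x = 0} f1) + (kinetic \<kappa> \<rho> f2 + \<gamma> * mass {x. snd x = 0} f2)
        + \<epsilon> * N + \<gamma> * (\<Sum>x\<in>F. (cmod (l2_fun f x))\<^sup>2)"
      using kin mult_left_mono[OF m2 assms(3)] unfolding m1 by (simp add: distrib_left)
    also have "\<dots> \<le> M / 2 * (norm f1)\<^sup>2 + M / 2 * (norm f2)\<^sup>2 + \<epsilon> * N + \<gamma> * (\<Sum>x\<in>F. (cmod (l2_fun f x))\<^sup>2)"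
      by (intro add_mono order_refl half_space_bound assms)
    also have "\<dots> = (M / 2 + \<epsilon>) * N + \<gamma> * (\<Sum>x\<in>F. (cmod (l2_fun f x))\<^sup>2)"
      unfolding N by (simp add: algebra_simps)
    finally show ?thesis by (simp add: N_def)
  qed
  with F show ?thesis by blast
qed

section \<open>The variational top of the spectrum\<close>

text \<open>\<open>M\<close> is the supremum of the form over the unit sphere, which is nonempty
  because of \<open>f\<^sub>0\<close>; homogeneity extends the bound to all vectors.\<close>

lemma exists_maximizing_sequence:
  fixes T :: "'h::{real_inner, complete_space} \<Rightarrow> 'h"
  assumes lin: "bounded_linear T" and sym: "\<And>f g. T f \<bullet> g = f \<bullet> T g" and "f\<^sub>0 \<noteq> (0 :: 'h)"
  obtains M X where "symmetric_operator T M" "\<And>n :: nat. norm (X n) = 1" "(\<lambda>n. T (X n) \<bullet> X n) \<longlonglongrightarrow> M"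
proof -
  interpret bounded_linear T by (rule lin)
  define S where "S = {T f \<bullet> f |f. norm f = 1}"
  define M where "M = Sup S"
  have "norm (sgn f\<^sub>0) = 1" using assms(3) by (simp add: norm_sgn)
  then have ne: "S \<noteq> {}" by (auto simp: S_def)
  obtain K where K: "\<And>f. norm (T f) \<le> norm f * K" using bounded by blast
  have "T f \<bullet> f \<le> K" if "norm f = 1" for f
    using norm_cauchy_schwarz[of "T f" f] K[of f] that by simp
  then have bdd: "bdd_above S" by (auto simp: S_def intro!: bdd_aboveI)
  have "T f \<bullet> f \<le> M * (norm f)\<^sup>2" for f
  proof (cases "f = 0")
    case False
    define u where "u = sgn f"
    have u: "norm u = 1" "f = norm f *\<^sub>R u"
      using False by (simp_all add: u_def norm_sgn sgn_div_norm)
    have "T f \<bullet> f = (norm f)\<^sup>2 * (T u \<bullet> u)"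
      using scaleR[of "norm f" u] u(2)
      by (metis inner_scaleR_left inner_scaleR_right mult.assoc power2_eq_square)
    also have "\<dots> \<le> (norm f)\<^sup>2 * M"
      unfolding M_def using u(1) by (intro mult_left_mono cSup_upper bdd) (auto simp: S_def)
    finally show ?thesis by (simp add: mult.commute)
  qed (simp add: zero)
  then have op: "symmetric_operator T M"
    using lin sym by unfold_locales auto
  have "\<exists>f. norm f = 1 \<and> M - inverse (real (Suc n)) < T f \<bullet> f" for n
  proof -
    have "M - inverse (real (Suc n)) < Sup S" by (simp add: M_def)
    then obtain s where "s \<in> S" "M - inverse (real (Suc n)) < s"
      using less_cSupD[OF ne] by blast
    then show ?thesis by (auto simp: S_def)
  qed
  then obtain X where X: "\<And>n. norm (X n) = 1" "\<And>n. M - inverse (real (Suc n)) < T (X n) \<bullet> X n"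
    by metis
  have "(\<lambda>n. T (X n) \<bullet> X n) \<longlonglongrightarrow> M"
  proof (rule tendsto_sandwich)
    show "\<forall>\<^sub>F n in sequentially. M - inverse (real (Suc n)) \<le> T (X n) \<bullet> X n"
      using X(2) by (intro always_eventually) (auto intro: less_imp_le)
    show "\<forall>\<^sub>F n in sequentially. T (X n) \<bullet> X n \<le> M"
      using symmetric_operator.upper[OF op] X(1) by (intro always_eventually allI) (metis mult.right_neutral power_one)
    show "(\<lambda>n. M - inverse (real (Suc n))) \<longlonglongrightarrow> M"
      using tendsto_diff[OF tendsto_const LIMSEQ_inverse_real_of_nat, of M] by simp
  qed simp
  with op X(1) show thesis using that by blast
qed

section \<open>Spectrum and eigenfunctions\<close>

lemma l2_fun_cmult: "l2_fun (lmult (\<lambda>_. c) f) x = c * l2_fun f x"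
  by (rule l2_fun_lmult[where K = "cmod c"]) simp

text \<open>Above \<open>M\<close>, coercivity and surjectivity produce a bounded inverse. At
  \<open>M\<close>, a maximizing sequence consists of approximate eigenvectors, which a bounded
  inverse excludes. So \<open>M\<close> is the largest real point of the spectrum.\<close>

lemma sup_spectrum_eq:
  fixes T :: "'a l2 \<Rightarrow> 'a l2" and H :: "('a \<Rightarrow> complex) \<Rightarrow> 'a \<Rightarrow> complex"
  assumes op: "symmetric_operator T M"
    and TH: "\<And>f. l2_fun (T f) = H (l2_fun f)"
    and hom: "\<And>c f. H (\<lambda>x. c * f x) = (\<lambda>x. c * H f x)"
    and unit: "\<And>n :: nat. norm (X n) = 1" and max: "(\<lambda>n. T (X n) \<bullet> X n) \<longlonglongrightarrow> M"
  shows "sup_spectrum H = M"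
proof -
  interpret symmetric_operator T M by fact
  have resolvent: "complex_of_real z \<in> ell2_resolvent_set H" if z: "z > M" for z
  proof -
    define S where "S f = T f - z *\<^sub>R f" for f
    define R where "R f = l2_fun (inv S (to_l2 f))" for f
    have S_fun: "l2_fun (S f) = (\<lambda>x. H (l2_fun f) x - complex_of_real z * l2_fun f x)" for f
      by (auto simp: S_def TH scaleR_conv_of_real)
    have Slin: "S (f + g) = S f + S g" for f g
      by (simp add: S_def linear_simps[OF lin] algebra_simps)
    have Sdiff: "S (f - g) = S f - S g" for f g
      by (simp add: S_def linear_simps[OF lin] algebra_simps)
    \<comment> \<open>A resolvent must be complex linear, whereas \<open>T\<close> is given as a
      real linear map; homogeneity is imported from \<open>H\<close>.\<close>
    have Shom: "S (lmult (\<lambda>_. c) f) = lmult (\<lambda>_. c) (S f)" for c f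
    proof (rule l2_eqI)
      have "l2_fun (lmult (\<lambda>_. c) f) = (\<lambda>x. c * l2_fun f x)" by (auto simp: l2_fun_cmult)
      then show "l2_fun (S (lmult (\<lambda>_. c) f)) x = l2_fun (lmult (\<lambda>_. c) (S f)) x" for x
        unfolding S_fun l2_fun_cmult by (simp add: hom algebra_simps)
    qed
    have bound: "norm f \<le> norm (S f) / (z - M)" for f
      unfolding S_def by (rule coercive[OF z])
    have inj: "inj S"
    proof (rule injI)
      fix f g assume "S f = S g"
      then show "f = g" using bound[of "f - g"] by (simp add: Sdiff)
    qed
    have surj: "surj S"
      using surj_above[OF z] unfolding S_def surj_def by metis
    have SR: "S (inv S g) = g" for g by (rule surj_f_inv_f[OF surj])
    have RS: "inv S (S g) = g" for g by (rule inv_f_f[OF inj])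
    have "ell2_bounded_op R"
      unfolding ell2_bounded_op_def
    proof (intro conjI ballI allI)
      fix f g :: "'a \<Rightarrow> complex" assume f: "f \<in> ell2" and g: "g \<in> ell2"
      have "to_l2 (\<lambda>x. f x + g x) = to_l2 f + to_l2 g"
        by (rule l2_eqI) (simp add: to_l2_inverse f g ell2_add)
      then have "to_l2 (\<lambda>x. f x + g x) = S (inv S (to_l2 f) + inv S (to_l2 g))"
        by (simp add: Slin SR)
      then show "R (\<lambda>x. f x + g x) = (\<lambda>x. R f x + R g x)"
        by (auto simp: R_def RS)
    next
      fix c and f :: "'a \<Rightarrow> complex" assume f: "f \<in> ell2"
      have "to_l2 (\<lambda>x. c * f x) = lmult (\<lambda>_. c) (to_l2 f)"
        by (rule l2_eqI) (simp add: to_l2_inverse f ell2_cmult l2_fun_cmult)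
      then have "to_l2 (\<lambda>x. c * f x) = S (lmult (\<lambda>_. c) (inv S (to_l2 f)))"
        by (simp add: Shom SR)
      then show "R (\<lambda>x. c * f x) = (\<lambda>x. c * R f x)"
        by (auto simp: R_def RS l2_fun_cmult)
    next
      have "ell2_norm (R f) \<le> (1 / (z - M)) * ell2_norm f" if f: "f \<in> ell2" for f
        using bound[of "inv S (to_l2 f)"] f
        by (simp add: SR R_def norm_l2_def to_l2_inverse)
      then show "\<exists>C. \<forall>f\<in>ell2. ell2_norm (R f) \<le> C * ell2_norm f" by blast
    qed (simp add: R_def)
    moreover have "R (\<lambda>x. H f x - complex_of_real z * f x) = f \<and> (\<lambda>x. H (R f) x - complex_of_real z * R f x) = f"
      if f: "f \<in> ell2" for f
    proof
      have ff: "l2_fun (to_l2 f) = f" using f by (rule to_l2_inverse)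
      show "R (\<lambda>x. H f x - complex_of_real z * f x) = f"
        using S_fun[of "to_l2 f"] unfolding ff R_def by (metis RS ff l2_fun_inverse)
      show "(\<lambda>x. H (R f) x - complex_of_real z * R f x) = f"
        unfolding R_def S_fun[symmetric] by (simp add: SR ff)
    qed
    ultimately show ?thesis unfolding ell2_resolvent_set_def by blast
  qed
  have spectrum: "complex_of_real M \<in> ell2_spectrum H"
    unfolding ell2_spectrum_def
  proof
    assume "complex_of_real M \<in> ell2_resolvent_set H"
    then obtain R where R: "ell2_bounded_op R"
      "\<And>f. f \<in> ell2 \<Longrightarrow> R (\<lambda>x. H f x - complex_of_real M * f x) = f"
      unfolding ell2_resolvent_set_def by blast
    then obtain C where C: "\<And>f. f \<in> ell2 \<Longrightarrow> ell2_norm (R f) \<le> C * ell2_norm f"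
      unfolding ell2_bounded_op_def by blast
    obtain K where K: "\<And>f. (norm (M *\<^sub>R f - T f))\<^sup>2 \<le> K * gap f"
      using defect_sq_le_gap by blast
    define D where "D n = norm (T (X n) - M *\<^sub>R X n)" for n
    \<comment> \<open>A left inverse with bound \<open>C\<close> would keep the defects of unit
      vectors away from zero, but \<open>defect_sq_le_gap\<close> sends them to zero.\<close>
    have low: "1 \<le> C * D n" for n
    proof -
      have "l2_fun (T (X n) - M *\<^sub>R X n) = (\<lambda>x. H (l2_fun (X n)) x - complex_of_real M * l2_fun (X n) x)"
        by (auto simp: TH scaleR_conv_of_real)
      then have "ell2_norm (l2_fun (X n)) \<le> C * ell2_norm (l2_fun (T (X n) - M *\<^sub>R X n))"
        using R(2)[of "l2_fun (X n)"] C[of "l2_fun (T (X n) - M *\<^sub>R X n)"]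
        by (metis l2_fun_ell2)
      then show ?thesis by (simp add: D_def unit flip: norm_l2_def)
    qed
    have "(\<lambda>n. K * gap (X n)) \<longlonglongrightarrow> K * (M - M)"
      unfolding gap_def unit power_one mult_1_right by (intro tendsto_intros max)
    then have "(\<lambda>n. (D n)\<^sup>2) \<longlonglongrightarrow> 0"
      by (intro tendsto_sandwich[OF _ _ tendsto_const, of 0 "\<lambda>n. (D n)\<^sup>2" sequentially "\<lambda>n. K * gap (X n)"])
        (use K in \<open>auto simp: D_def norm_minus_commute\<close>)
    then have "(\<lambda>n. sqrt ((D n)\<^sup>2)) \<longlonglongrightarrow> sqrt 0" by (rule tendsto_real_sqrt)
    then have "D \<longlonglongrightarrow> 0" by (simp add: D_def[abs_def])
    then have "(\<lambda>n. C * D n) \<longlonglongrightarrow> C * 0" by (intro tendsto_intros)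
    then have "1 \<le> C * 0" by (rule LIMSEQ_le_const) (use low in blast)
    then show False by simp
  qed
  show ?thesis
    unfolding sup_spectrum_def
  proof (rule cSup_eq_maximum)
    show "M \<in> {r. complex_of_real r \<in> ell2_spectrum H}" using spectrum by simp
    show "r \<le> M" if "r \<in> {r. complex_of_real r \<in> ell2_spectrum H}" for r
      using resolvent[of r] that unfolding ell2_spectrum_def by force
  qed
qed

text \<open>The symmetry of \<open>T\<close> is tested against \<open>\<i>\<close> times
  \<open>f\<close>: the two sides are \<open>Im z\<close> and \<open>- Im z\<close> times the
  squared norm. The test vector \<open>f\<close> itself would only reveal
  \<open>Re z\<close>.\<close>

lemma real_eigenvalue:
  fixes T :: "'a l2 \<Rightarrow> 'a l2" and H :: "('a \<Rightarrow> complex) \<Rightarrow> 'a \<Rightarrow> complex"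
  assumes sym: "\<And>f g. T f \<bullet> g = f \<bullet> T g"
    and TH: "\<And>f. l2_fun (T f) = H (l2_fun f)"
    and hom: "\<And>c f. H (\<lambda>x. c * f x) = (\<lambda>x. c * H f x)"
    and eig: "H (l2_fun f) = (\<lambda>x. z * l2_fun f x)" and "f \<noteq> 0"
  shows "z \<in> \<real>" "T f = Re z *\<^sub>R f"
proof -
  define g where "g = lmult (\<lambda>_. \<i>) f"
  have g: "l2_fun g = (\<lambda>x. \<i> * l2_fun f x)" by (auto simp: g_def l2_fun_cmult)
  have pw: "(z * a) \<bullet> (\<i> * a) = Im z * (cmod a)\<^sup>2" "a \<bullet> (\<i> * (z * a)) = - Im z * (cmod a)\<^sup>2" for a
    unfolding cmod_power2 by (simp_all add: inner_complex_def power2_eq_square algebra_simps)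
  have "T f \<bullet> g = Im z * (norm f)\<^sup>2"
    by (simp add: inner_l2_def TH eig g pw infsum_cmult_right' l2_norm_sq)
  moreover have "f \<bullet> T g = - Im z * (norm f)\<^sup>2"
    unfolding inner_l2_def TH g hom eig pw by (simp add: infsum_cmult_right' l2_norm_sq infsum_uminus)
  ultimately have "Im z = 0" using sym[of f g] \<open>f \<noteq> 0\<close> by simp
  then show r: "z \<in> \<real>" by (simp add: complex_is_Real_iff)
  show "T f = Re z *\<^sub>R f"
    by (rule l2_eqI) (use \<open>Im z = 0\<close> in \<open>simp add: TH eig scaleR_conv_of_real complex_eq_iff\<close>)
qed

section \<open>Eigenfunctions at the top have no zeros\<close>

lemma op_H2_cmult: "op_H2 \<kappa> \<rho> \<gamma> (\<lambda>x. c * f x) = (\<lambda>x. c * op_H2 \<kappa> \<rho> \<gamma> f x)"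
  by (rule ext) (simp add: op_H2_def op_A2_def op_V2_def algebra_simps sum_distrib_left)

text \<open>A discrete strong maximum principle. The absolute value of \<open>f\<close> is again a
  maximizer, hence an eigenfunction; at a zero its equation says that a sum of nonnegative neighbour
  values vanishes, so the zero spreads to the neighbours and then over the lattice.\<close>

lemma top_eigenfunction_nonzero:
  fixes f :: "((int ^ 'd::finite) \<times> (int ^ 'd)) l2"
  assumes "\<kappa> > 0" "\<rho> \<ge> 0" and op: "symmetric_operator (hamiltonian \<kappa> \<rho> \<gamma> :: ((int ^ 'd) \<times> (int ^ 'd)) l2 \<Rightarrow> _) M"
    and eig: "hamiltonian \<kappa> \<rho> \<gamma> f = M *\<^sub>R f" and "f \<noteq> 0"
  shows "l2_fun f x \<noteq> 0"
proof
  assume fx: "l2_fun f x = 0"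
  define g where "g = l2_abs f"
  have "M * (norm g)\<^sup>2 \<le> hamiltonian \<kappa> \<rho> \<gamma> g \<bullet> g"
    using hamiltonian_l2_abs[of \<kappa> \<rho> \<gamma> f] assms(1,2) by (simp add: eig g_def power2_norm_eq_inner)
  then have "hamiltonian \<kappa> \<rho> \<gamma> g = M *\<^sub>R g"
    using symmetric_operator.upper[OF op, of g]
    by (intro symmetric_operator.maximizer_is_eigenvector[OF op]) simp
  then have H: "op_H2 \<kappa> \<rho> \<gamma> (l2_fun g) y = M * l2_fun g y" for y
    by (metis l2_fun_hamiltonian l2_fun_scaleR scaleR_conv_of_real)
  define h where "h y = cmod (l2_fun f y)" for y
  have gh: "l2_fun g y = complex_of_real (h y)" for y by (simp add: g_def h_def)
  have step: "h (y + e) = 0" if "h y = 0" "e \<in> lattice_pair_units" for y e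
  proof -
    \<comment> \<open>At a zero of \<open>h\<close> the diagonal terms, the potential and the
      right-hand side all vanish.\<close>
    have "complex_of_real (\<kappa> * (\<Sum>e\<in>lattice_pair_units. h (y + e)) + \<rho> * (\<Sum>e\<in>lattice_units. h (fst y + e, snd y + e))) = 0"
      using H[of y] that(1) by (simp add: op_H2_def op_A2_def op_V2_def gh)
    then have 0: "\<kappa> * (\<Sum>e\<in>lattice_pair_units. h (y + e)) + \<rho> * (\<Sum>e\<in>lattice_units. h (fst y + e, snd y + e)) = 0"
      unfolding of_real_eq_0_iff .
    have "(\<Sum>e\<in>lattice_pair_units. h (y + e)) \<ge> 0"
      "\<rho> * (\<Sum>e\<in>lattice_units. h (fst y + e, snd y + e)) \<ge> 0"
      using assms(2) by (auto simp: h_def intro!: sum_nonneg mult_nonneg_nonneg)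
    then have "(\<Sum>e\<in>lattice_pair_units. h (y + e)) = 0"
      using 0 assms(1) by (smt (verit) mult_pos_pos)
    then show ?thesis
      using that(2) by (subst (asm) sum_nonneg_eq_0_iff) (auto simp: h_def finite_lattice_pair_units)
  qed
  have "h (y, z) = 0" for y z
  proof -
    \<comment> \<open>The zero is moved along the first coordinate, then along the second.\<close>
    have "h (y, snd x) = 0"
    proof (rule lattice_connected[of "\<lambda>y. h (y, snd x) = 0" "fst x"])
      show "h (fst x, snd x) = 0" using fx by (simp add: h_def)
      show "h (a + e, snd x) = 0" if "h (a, snd x) = 0" "e \<in> lattice_units" for a e
        using step[OF that(1), of "(e, 0)"] that(2) by (simp add: lattice_pair_units_eq)
    qed
    then show ?thesis
    proof (rule lattice_connected[of "\<lambda>z. h (y, z) = 0" "snd x"])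
      show "h (y, a + e) = 0" if "h (y, a) = 0" "e \<in> lattice_units" for a e
        using step[OF that(1), of "(0, e)"] that(2) by (simp add: lattice_pair_units_eq)
    qed
  qed
  then have "f = 0" by (intro l2_eqI) (auto simp: h_def)
  with \<open>f \<noteq> 0\<close> show False ..
qed

section \<open>Existence, positivity, simplicity and isolation of the top eigenvalue\<close>

theorem theorem6:
  fixes \<kappa> \<rho> \<gamma> lam\<^sub>2 :: real
    and H :: "((int ^ 'd::finite) \<times> (int ^ 'd) \<Rightarrow> complex) \<Rightarrow> (int ^ 'd) \<times> (int ^ 'd) \<Rightarrow> complex"
  assumes "\<kappa> > 0" and "\<rho> > 0" and "\<gamma> > 0"
    and "H = op_H2 \<kappa> \<rho> \<gamma>"
    and "lam\<^sub>2 = sup_spectrum H"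
    and "lam\<^sub>2 > 0"
  shows "complex_of_real lam\<^sub>2 \<in> ell2_point_spectrum H \<and>
    complex_of_real lam\<^sub>2 isolated_in ell2_point_spectrum H \<and>
    cfun_dim (ell2_eigenspace H (complex_of_real lam\<^sub>2)) = 1 \<and>
    (\<exists>g :: (int ^ 'd) \<times> (int ^ 'd) \<Rightarrow> real. (\<forall>x. g x > 0) \<and>
       (\<lambda>x. complex_of_real (g x)) \<in> ell2_eigenspace H (complex_of_real lam\<^sub>2))"
proof -
  define T :: "((int ^ 'd) \<times> (int ^ 'd)) l2 \<Rightarrow> ((int ^ 'd) \<times> (int ^ 'd)) l2"
    where "T = hamiltonian \<kappa> \<rho> \<gamma>"
  have lin: "bounded_linear T" unfolding T_def by (rule bounded_linear_hamiltonian)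
  have sym: "T f \<bullet> g = f \<bullet> T g" for f g unfolding T_def by (rule hamiltonian_symmetric)
  have TH: "l2_fun (T f) = H (l2_fun f)" for f
    unfolding T_def assms(4) by (rule l2_fun_hamiltonian)
  have hom: "H (\<lambda>x. c * f x) = (\<lambda>x. c * H f x)" for c f
    unfolding assms(4) by (rule op_H2_cmult)
  \<comment> \<open>A nonzero vector, as required for a maximizing sequence.\<close>
  define \<delta>\<^sub>0 :: "((int ^ 'd) \<times> (int ^ 'd)) l2" where "\<delta>\<^sub>0 = to_l2 (indicator {0})"
  have "(indicator {0} :: (int ^ 'd) \<times> (int ^ 'd) \<Rightarrow> complex) \<in> ell2"
    unfolding ell2_def mem_Collect_eq
    by (rule finite_nonzero_values_imp_summable_on) (simp add: indicator_def)
  then have "l2_fun \<delta>\<^sub>0 0 \<noteq> l2_fun 0 0" by (simp add: \<delta>\<^sub>0_def to_l2_inverse)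
  then have "\<delta>\<^sub>0 \<noteq> 0" by metis
  then obtain M X where op: "symmetric_operator T M" and X: "\<And>n :: nat. norm (X n) = 1" "(\<lambda>n. T (X n) \<bullet> X n) \<longlonglongrightarrow> M"
    using exists_maximizing_sequence[OF lin sym] by metis
  have M: "lam\<^sub>2 = M"
    unfolding assms(5) by (rule sup_spectrum_eq[OF op TH hom X])
  then have "M > 0" using assms(6) by simp
  \<comment> \<open>Here \<open>M > 0\<close> enters: with \<open>\<epsilon> = M / 4\<close> the
    essential bound is \<open>3 * M / 4 = M - M / 4\<close>, strictly below
    \<open>M\<close>.\<close>
  obtain F where F: "finite F"
    "\<And>f. T f \<bullet> f \<le> (M / 2 + M / 4) * (norm f)\<^sup>2 + \<gamma> * (\<Sum>x\<in>F. (cmod (l2_fun f x))\<^sup>2)"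
    using essential_bound[of \<kappa> \<rho> \<gamma> "M / 4" M] symmetric_operator.upper[OF op] assms(1-3) \<open>M > 0\<close>
    unfolding T_def by auto
  \<comment> \<open>Applied to \<open>X\<close> this gives an eigenvector; applied to eigenvectors
    whose eigenvalues tend to \<open>M\<close> it excludes accumulation.\<close>
  have maximizing: "\<exists>f r. strict_mono r \<and> (Y \<circ> r) \<longlonglongrightarrow> f \<and> norm f = 1 \<and> T f = M *\<^sub>R f"
    if "\<And>n. norm (Y n) = 1" "(\<lambda>n. T (Y n) \<bullet> Y n) \<longlonglongrightarrow> M" for Y
    by (rule maximizing_sequence_convergent[OF op F(1), where \<delta> = "M / 4" and C = \<gamma>])
      (use F(2) that \<open>M > 0\<close> in \<open>simp_all add: algebra_simps\<close>)
  obtain f where f: "norm f = 1" "T f = M *\<^sub>R f" using maximizing[OF X] by blast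
  have eig_iff: "l2_fun g \<in> ell2_eigenspace H (complex_of_real M) \<longleftrightarrow> T g = M *\<^sub>R g" for g
  proof -
    have "l2_fun (M *\<^sub>R g) = (\<lambda>x. complex_of_real M * l2_fun g x)"
      by (auto simp: scaleR_conv_of_real)
    then show ?thesis by (simp add: ell2_eigenspace_def flip: TH l2_fun_inject)
  qed
  have nonzero: "l2_fun g x \<noteq> 0" if "T g = M *\<^sub>R g" "g \<noteq> 0" for g x
    using top_eigenfunction_nonzero[OF assms(1) _ op[unfolded T_def]] assms(2) that
    unfolding T_def by auto
  have "f \<noteq> 0" using f(1) by auto
  have "T (l2_abs f) = M *\<^sub>R l2_abs f"
  proof (rule symmetric_operator.maximizer_is_eigenvector[OF op])
    have "M * (norm (l2_abs f))\<^sup>2 \<le> T (l2_abs f) \<bullet> l2_abs f"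
      using hamiltonian_l2_abs[of \<kappa> \<rho> \<gamma> f] assms(1,2) f unfolding T_def[symmetric]
      by (simp add: power2_norm_eq_inner[symmetric])
    then show "T (l2_abs f) \<bullet> l2_abs f = M * (norm (l2_abs f))\<^sup>2"
      using symmetric_operator.upper[OF op, of "l2_abs f"] by simp
  qed
  then have abs_eig: "l2_fun (l2_abs f) \<in> ell2_eigenspace H (complex_of_real M)"
    by (simp add: eig_iff)
  have positive: "\<exists>g :: (int ^ 'd) \<times> (int ^ 'd) \<Rightarrow> real. (\<forall>x. g x > 0) \<and>
       (\<lambda>x. complex_of_real (g x)) \<in> ell2_eigenspace H (complex_of_real M)"
  proof (intro exI conjI allI)
    show "cmod (l2_fun f x) > 0" for x using nonzero[OF f(2) \<open>f \<noteq> 0\<close>] by simp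
    have "l2_fun (l2_abs f) = (\<lambda>x. complex_of_real (cmod (l2_fun f x)))" by auto
    then show "(\<lambda>x. complex_of_real (cmod (l2_fun f x))) \<in> ell2_eigenspace H (complex_of_real M)"
      using abs_eig by simp
  qed
  have f_eig: "l2_fun f \<in> ell2_eigenspace H (complex_of_real M)" using f(2) by (simp add: eig_iff)
  have f_ne: "l2_fun f \<noteq> (\<lambda>x. 0)" using nonzero[OF f(2) \<open>f \<noteq> 0\<close>] by auto
  have point: "complex_of_real M \<in> ell2_point_spectrum H"
    using f_eig f_ne unfolding ell2_point_spectrum_def by blast
  have one_dim: "ell2_eigenspace H (complex_of_real M) = cfun.span {l2_fun f}"
  proof (intro equalityI subsetI)
    fix u assume u: "u \<in> ell2_eigenspace H (complex_of_real M)"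
    \<comment> \<open>With this \<open>c\<close> the eigenvector \<open>g\<close> vanishes at the
      origin, so it is zero by \<open>nonzero\<close>. The denominator is nonzero for the same
      reason.\<close>
    define c where "c = u 0 / l2_fun f 0"
    define g where "g = to_l2 u - lmult (\<lambda>_. c) f"
    have uu: "l2_fun (to_l2 u) = u" using u by (simp add: ell2_eigenspace_def to_l2_inverse)
    have "T (lmult (\<lambda>_. c) f) = M *\<^sub>R lmult (\<lambda>_. c) f"
    proof (rule l2_eqI)
      have "l2_fun (lmult (\<lambda>_. c) f) = (\<lambda>x. c * l2_fun f x)" by (auto simp: l2_fun_cmult)
      then have "l2_fun (T (lmult (\<lambda>_. c) f)) x = c * l2_fun (T f) x" for x by (simp add: TH hom)
      then show "l2_fun (T (lmult (\<lambda>_. c) f)) x = l2_fun (M *\<^sub>R lmult (\<lambda>_. c) f) x" for x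
        by (simp add: f(2) l2_fun_cmult scaleR_conv_of_real)
    qed
    moreover have "T (to_l2 u) = M *\<^sub>R to_l2 u" using u by (simp add: uu flip: eig_iff)
    ultimately have "T g = M *\<^sub>R g"
      by (simp add: g_def linear_simps[OF lin] scaleR_diff_right)
    moreover have "l2_fun g 0 = 0"
      using nonzero[OF f(2) \<open>f \<noteq> 0\<close>] by (simp add: g_def uu l2_fun_cmult c_def)
    ultimately have "g = 0" using nonzero by blast
    then have "to_l2 u = lmult (\<lambda>_. c) f" by (simp add: g_def)
    then have "u = (\<lambda>x. c * l2_fun f x)" by (metis ext l2_fun_cmult uu)
    then show "u \<in> cfun.span {l2_fun f}" by (auto simp: cfun.span_singleton)
  next
    fix u assume "u \<in> cfun.span {l2_fun f}"
    then obtain c where "u = (\<lambda>x. c * l2_fun f x)" by (auto simp: cfun.span_singleton)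
    then show "u \<in> ell2_eigenspace H (complex_of_real M)"
      using f_eig by (auto simp: ell2_eigenspace_def hom ell2_cmult)
  qed
  have independent: "\<not> cfun.dependent {l2_fun f}"
    using f_ne by (simp add: cfun.dependent_single zero_fun_def)
  have dim: "cfun_dim (ell2_eigenspace H (complex_of_real M)) = 1"
    unfolding one_dim cfun.dim_span_eq_card_independent[OF independent] by simp
  have "\<not> complex_of_real M islimpt ell2_point_spectrum H"
  proof
    assume "complex_of_real M islimpt ell2_point_spectrum H"
    then obtain z where z: "\<And>n. z n \<in> ell2_point_spectrum H - {complex_of_real M}" "z \<longlonglongrightarrow> complex_of_real M"
      unfolding islimpt_sequential by blast
    have "\<exists>g. norm g = 1 \<and> T g = Re (z n) *\<^sub>R g \<and> Re (z n) \<noteq> M" for n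
    proof -
      obtain u where u: "u \<in> ell2" "H u = (\<lambda>x. z n * u x)" "u \<noteq> (\<lambda>x. 0)"
        using z(1)[of n] unfolding ell2_point_spectrum_def ell2_eigenspace_def by blast
      define g where "g = to_l2 u"
      have gu: "l2_fun g = u" by (simp add: g_def to_l2_inverse u(1))
      have "g \<noteq> 0" using u(3) gu by auto
      note r = real_eigenvalue[OF sym TH hom u(2)[folded gu] this]
      \<comment> \<open>\<open>z n\<close> is real, so differing from \<open>M\<close> as a complex
        number means differing in the real part.\<close>
      have "Re (z n) \<noteq> M" using r(1) z(1)[of n] by (auto simp: complex_is_Real_iff complex_eq_iff)
      moreover have "T (sgn g) = Re (z n) *\<^sub>R sgn g"
        by (simp add: sgn_div_norm linear_simps[OF lin] r(2))
      moreover have "norm (sgn g) = 1" using \<open>g \<noteq> 0\<close> by (simp add: norm_sgn)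
      ultimately show ?thesis by blast
    qed
    then obtain Y where Y: "\<And>n. norm (Y n) = 1" "\<And>n. T (Y n) = Re (z n) *\<^sub>R Y n" "\<And>n. Re (z n) \<noteq> M"
      by metis
    have "(\<lambda>n. Re (z n)) \<longlonglongrightarrow> M" using tendsto_Re[OF z(2)] by simp
    moreover have "T (Y n) \<bullet> Y n = Re (z n)" for n
      using Y(1)[of n] by (simp add: Y(2) power2_norm_eq_inner[symmetric])
    ultimately have "(\<lambda>n. T (Y n) \<bullet> Y n) \<longlonglongrightarrow> M" by simp
    then obtain g r where g: "(Y \<circ> r) \<longlonglongrightarrow> g" "norm g = 1" "T g = M *\<^sub>R g"
      using maximizing[of Y, OF Y(1)] by blast
    \<comment> \<open>Eigenvectors of distinct eigenvalues are orthogonal, yet a subsequence of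
      \<open>Y\<close> converges to the unit vector \<open>g\<close>.\<close>
    have "Y n \<bullet> g = 0" for n
      using sym[of "Y n" g] Y(3)[of n] by (simp add: Y(2) g(3))
    then have "(\<lambda>n. (Y \<circ> r) n \<bullet> g) \<longlonglongrightarrow> 0" by simp
    moreover have "(\<lambda>n. (Y \<circ> r) n \<bullet> g) \<longlonglongrightarrow> g \<bullet> g" by (intro tendsto_intros g(1))
    ultimately have "g \<bullet> g = 0" using LIMSEQ_unique by blast
    then show False using g(2) by simp
  qed
  then show ?thesis
    unfolding M using point dim positive by (simp add: isolated_in_islimpt_iff)
qed

end
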